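(* For every finite graph $G$ in which every component has at least two vertices, $\gamma_{b}(G)\leq\frac{5}{4}\operatorname{ir}_{b}(G)$.
   Context: Let $G=(V,E)$ be a finite connected graph with at least two vertices, and let $e(v)$ denote the eccentricity of $v$. A broadcast on $G$ is a function $f:V\to\{0,1,\dots,\operatorname{diam}(G)\}$ with $f(v)\le e(v)$ for all $v$. If $G$ is disconnected, a broadcast on $G$ is a union of broadcasts on its components. The cost of $f$ is $\sigma(f)=\sum_{v\in V}f(v)$. Let $V_f^+=\{v:f(v)>0\}$. A vertex $u$ hears $f$ from $v\in V_f^+$ (and $v$ $f$-dominates $u$) if $d(u,v)\le f(v)$. The broadcast $f$ is dominating if every vertex hears $f$ from some vertex of $V_f^+$. The broadcast number is $\gamma_b(G)=\min\{\sigma(f): f \text{ a dominating broadcast of } G\}$. For $v\in V_f^+$, let $N_f[v]=\{u:d(u,v)\le f(v)\}$. The $f$-private boundary $\operatorname{PB}_f(v)$ is the set of vertices $u\in N_f[v]$ that are not dominated by the broadcast obtained from $f$ by replacing the value $f(v)$ with $f(v)-1$, all other values unchanged. The broadcast $f$ is irredundant if $\operatorname{PB}_f(v)\neq\varnothing$ for every $v\in V_f^+$. For broadcasts $f$ and $g$, write $g>f$ if $g(v)\ge f(v)$ for all $v$, with strict inequality for at least one $v$. An irredundant broadcast $f$ is maximal irredundant if no broadcast $g>f$ is irredundant. Define $\operatorname{ir}_b(G)=\min\{\sigma(f): f \text{ a maximal irredundant broadcast of } G\}$. *)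

theory Defs
  imports "Graph_Theory.Graph_Theory"
begin

text \<open>
  Finite simple graphs are rendered by the locale \<open>graph\<close> (finite, symmetric, without loops and
  parallel arcs), and their components by \<open>sccs\<close>. The distance is the shortest-path distance for
  unit arc weights; it is infinite between different components.
\<close>

definition gdist :: "('a, 'b) pre_digraph \<Rightarrow> 'a \<Rightarrow> 'a \<Rightarrow> ereal" where
  "gdist G u v = wf_digraph.\<mu> G (\<lambda>_. 1) u v"

definition eccentricity :: "('a, 'b) pre_digraph \<Rightarrow> 'a \<Rightarrow> ereal" where
  "eccentricity G v = (SUP u\<in>verts G. gdist G u v)"

definition diam :: "('a, 'b) pre_digraph \<Rightarrow> ereal" where
  "diam G = (SUP v\<in>verts G. eccentricity G v)"

text \<open>
  A function on the vertices is a total function whose values outside \<open>verts G\<close> are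
  ignored by all notions below.
\<close>

definition connected_broadcast :: "('a, 'b) pre_digraph \<Rightarrow> ('a \<Rightarrow> nat) \<Rightarrow> bool" where
  "connected_broadcast G f \<longleftrightarrow>
     (\<forall>v\<in>verts G. ereal (real (f v)) \<le> diam G \<and> ereal (real (f v)) \<le> eccentricity G v)"

text \<open>A nonempty connected graph is its own only component, so no case distinction is needed.\<close>

definition broadcast :: "('a, 'b) pre_digraph \<Rightarrow> ('a \<Rightarrow> nat) \<Rightarrow> bool" where
  "broadcast G f \<longleftrightarrow> (\<forall>H\<in>pre_digraph.sccs G. connected_broadcast H f)"

definition cost :: "('a, 'b) pre_digraph \<Rightarrow> ('a \<Rightarrow> nat) \<Rightarrow> nat" where
  "cost G f = (\<Sum>v\<in>verts G. f v)"

definition Vplus :: "('a, 'b) pre_digraph \<Rightarrow> ('a \<Rightarrow> nat) \<Rightarrow> 'a set" where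
  "Vplus G f = {v \<in> verts G. 0 < f v}"

definition hears :: "('a, 'b) pre_digraph \<Rightarrow> ('a \<Rightarrow> nat) \<Rightarrow> 'a \<Rightarrow> 'a \<Rightarrow> bool" where
  "hears G f u v \<longleftrightarrow> v \<in> Vplus G f \<and> gdist G u v \<le> ereal (real (f v))"

definition dominated :: "('a, 'b) pre_digraph \<Rightarrow> ('a \<Rightarrow> nat) \<Rightarrow> 'a \<Rightarrow> bool" where
  "dominated G f u \<longleftrightarrow> (\<exists>v\<in>Vplus G f. hears G f u v)"

definition dominating_broadcast :: "('a, 'b) pre_digraph \<Rightarrow> ('a \<Rightarrow> nat) \<Rightarrow> bool" where
  "dominating_broadcast G f \<longleftrightarrow> broadcast G f \<and> (\<forall>u\<in>verts G. dominated G f u)"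

definition broadcast_number :: "('a, 'b) pre_digraph \<Rightarrow> nat" where
  "broadcast_number G = (LEAST k. \<exists>f. dominating_broadcast G f \<and> cost G f = k)"

definition broadcast_nbhd :: "('a, 'b) pre_digraph \<Rightarrow> ('a \<Rightarrow> nat) \<Rightarrow> 'a \<Rightarrow> 'a set" where
  "broadcast_nbhd G f v = {u \<in> verts G. gdist G u v \<le> ereal (real (f v))}"

definition private_boundary :: "('a, 'b) pre_digraph \<Rightarrow> ('a \<Rightarrow> nat) \<Rightarrow> 'a \<Rightarrow> 'a set" where
  "private_boundary G f v = {u \<in> broadcast_nbhd G f v. \<not> dominated G (f(v := f v - 1)) u}"

definition irredundant_broadcast :: "('a, 'b) pre_digraph \<Rightarrow> ('a \<Rightarrow> nat) \<Rightarrow> bool" where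
  "irredundant_broadcast G f \<longleftrightarrow>
     broadcast G f \<and> (\<forall>v\<in>Vplus G f. private_boundary G f v \<noteq> {})"

definition broadcast_less :: "('a, 'b) pre_digraph \<Rightarrow> ('a \<Rightarrow> nat) \<Rightarrow> ('a \<Rightarrow> nat) \<Rightarrow> bool" where
  "broadcast_less G f g \<longleftrightarrow> (\<forall>v\<in>verts G. f v \<le> g v) \<and> (\<exists>v\<in>verts G. f v < g v)"

definition maximal_irredundant_broadcast ::
    "('a, 'b) pre_digraph \<Rightarrow> ('a \<Rightarrow> nat) \<Rightarrow> bool" where
  "maximal_irredundant_broadcast G f \<longleftrightarrow>
     irredundant_broadcast G f \<and> \<not> (\<exists>g. broadcast_less G f g \<and> irredundant_broadcast G g)"

definition broadcast_irredundance_number :: "('a, 'b) pre_digraph \<Rightarrow> nat" where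
  "broadcast_irredundance_number G =
     (LEAST k. \<exists>f. maximal_irredundant_broadcast G f \<and> cost G f = k)"

end

theory Submission
  imports Defs
begin

text \<open>
  Let \<open>f\<close> be a maximal irredundant broadcast. By maximality, every undominated vertex is adjacent to
  the whole private boundary of some broadcasting vertex \<open>v\<close>; call such a \<open>v\<close> bad. It is at distance
  \<open>f v + 1\<close> from these undominated vertices. Group the balls of \<open>f\<close> into clusters, the components of
  their intersection graph. A cluster of total radius \<open>R\<close> lies in a single ball of radius \<open>R\<close>, and
  radius \<open>R + 1\<close> also reaches its undominated vertices, which is affordable if \<open>R \<ge> 4\<close>. For \<open>R \<le> 3\<close>
  a case analysis, using that raising bad values by one destroys irredundance, shows that either
  radius \<open>R\<close> already suffices, or the cluster comes within one step of the private boundary of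
  another cluster. In the latter case a linked pair can be merged into one ball of radius
  \<open>R + R' + 1\<close>, and further linked clusters join at the cost of their own total radius, so the
  extra \<open>1\<close> is paid once per group of total radius at least \<open>4\<close>.
\<close>

section \<open>Metric balls\<close>

text \<open>
  \<open>W n u v\<close> stands for \<open>d(u, v) \<le> n\<close>; this avoids infinite distances between components.
\<close>

locale ball_space =
  fixes V :: "'a set" and W :: "nat \<Rightarrow> 'a \<Rightarrow> 'a \<Rightarrow> bool"
  assumes finite_V: "finite V"
    and W_in: "W n u v \<Longrightarrow> v \<in> V"
    and W_0: "W 0 u v \<longleftrightarrow> u \<in> V \<and> u = v"
    and W_sym: "W n u v \<Longrightarrow> W n v u"
    and W_mono: "W m u v \<Longrightarrow> m \<le> n \<Longrightarrow> W n u v"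
    and W_trans: "W m u v \<Longrightarrow> W n v w \<Longrightarrow> W (m + n) u w"
    and W_split: "W (m + n) u w \<Longrightarrow> \<exists>v. W m u v \<and> W n v w"
    and W_nontrivial: "u \<in> V \<Longrightarrow> \<exists>v. W 1 u v \<and> v \<noteq> u"
begin

text \<open>\<open>g v\<close> is at most the eccentricity of \<open>v\<close> iff some vertex lies at distance exactly \<open>g v\<close>.\<close>

definition admissible :: "('a \<Rightarrow> nat) \<Rightarrow> bool" where
  "admissible g \<longleftrightarrow> (\<forall>v\<in>V. g v = 0 \<or> (\<exists>u. W (g v) v u \<and> \<not> W (g v - 1) v u))"

definition supp :: "('a \<Rightarrow> nat) \<Rightarrow> 'a set" where
  "supp g = {v \<in> V. 0 < g v}"

definition reached :: "('a \<Rightarrow> nat) \<Rightarrow> 'a \<Rightarrow> bool" where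
  "reached g u \<longleftrightarrow> (\<exists>v\<in>supp g. W (g v) v u)"

definition pb :: "('a \<Rightarrow> nat) \<Rightarrow> 'a \<Rightarrow> 'a set" where
  "pb g v = {u. W (g v) v u \<and> \<not> reached (g(v := g v - 1)) u}"

definition irr :: "('a \<Rightarrow> nat) \<Rightarrow> bool" where
  "irr g \<longleftrightarrow> admissible g \<and> (\<forall>v\<in>supp g. pb g v \<noteq> {})"

lemma W_near: "W m u v \<Longrightarrow> W n v w \<Longrightarrow> m + n \<le> k \<Longrightarrow> W k u w"
  using W_trans W_mono by blast

lemma W_refl: "u \<in> V \<Longrightarrow> W n u u"
  using W_0 W_mono by blast

text \<open>If \<open>g v = 1\<close>, lowering the value removes \<open>v\<close> from the support
  instead of leaving a ball of radius 0, so even \<open>v\<close> itself may lie in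
  \<open>pb g v\<close>; hence the separate disjunct.\<close>

lemma pb_iff:
  assumes "v \<in> supp g"
  shows "x \<in> pb g v \<longleftrightarrow> W (g v) v x \<and> (g v = 1 \<or> \<not> W (g v - 1) v x) \<and>
    (\<forall>z\<in>supp g. z \<noteq> v \<longrightarrow> \<not> W (g z) z x)"
  using assms unfolding pb_def reached_def supp_def by (auto split: if_splits)

text \<open>The radii in \<open>h\<close> are not bounded by eccentricities, so balls can be
  enlarged and added freely; the bound is restored at the very end.\<close>

definition coverable :: "'a set \<Rightarrow> nat \<Rightarrow> bool" where
  "coverable X k \<longleftrightarrow> (\<exists>h. sum h V \<le> k \<and> (\<forall>x\<in>X. \<exists>v. 0 < h v \<and> W (h v) v x))"

lemma coverable_empty: "coverable {} 0"
  unfolding coverable_def by (intro exI[of _ "\<lambda>_. 0"]) auto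

lemma coverable_mono: "coverable X k \<Longrightarrow> Y \<subseteq> X \<Longrightarrow> coverable Y k"
  unfolding coverable_def by blast

lemma coverable_ball:
  assumes "\<And>x. x \<in> X \<Longrightarrow> W r c x" "0 < r"
  shows "coverable X r"
  unfolding coverable_def
proof (intro exI[of _ "\<lambda>v. if v = c then r else 0"] conjI)
  show "(\<Sum>v\<in>V. if v = c then r else 0) \<le> r"
    using finite_V by simp
qed (use assms in auto)

text \<open>Adding the radii handles a centre used by both covers: its ball only grows.\<close>

lemma coverable_Un:
  assumes "coverable X k" "coverable Y l"
  shows "coverable (X \<union> Y) (k + l)"
proof -
  obtain h where h: "sum h V \<le> k" "\<forall>x\<in>X. \<exists>v. 0 < h v \<and> W (h v) v x"
    using assms(1) unfolding coverable_def by blast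
  obtain h' where h': "sum h' V \<le> l" "\<forall>x\<in>Y. \<exists>v. 0 < h' v \<and> W (h' v) v x"
    using assms(2) unfolding coverable_def by blast
  show ?thesis unfolding coverable_def
  proof (intro exI[of _ "\<lambda>v. h v + h' v"] conjI ballI)
    show "(\<Sum>v\<in>V. h v + h' v) \<le> k + l"
      using h(1) h'(1) by (simp add: sum.distrib)
  next
    fix x assume "x \<in> X \<union> Y"
    then obtain v where "0 < h v \<and> W (h v) v x \<or> 0 < h' v \<and> W (h' v) v x"
      using h(2) h'(2) by blast
    then have "0 < h v + h' v \<and> W (h v + h' v) v x"
      using W_mono[of "h v" v x "h v + h' v"] W_mono[of "h' v" v x "h v + h' v"] by auto
    then show "\<exists>v. 0 < h v + h' v \<and> W (h v + h' v) v x" ..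
  qed
qed

text \<open>Truncating each radius at the eccentricity of its centre leaves every ball unchanged.\<close>

lemma coverable_imp_dominating:
  assumes "coverable V k"
  shows "\<exists>h. admissible h \<and> (\<forall>u\<in>V. reached h u) \<and> sum h V \<le> k"
proof -
  obtain h where h: "sum h V \<le> k" "\<forall>x\<in>V. \<exists>v. 0 < h v \<and> W (h v) v x"
    using assms unfolding coverable_def by blast
  define E where "E v n \<longleftrightarrow> n = 0 \<or> (\<exists>u. W n v u \<and> \<not> W (n - 1) v u)" for v n
  define h' where "h' v = (GREATEST n. n \<le> h v \<and> E v n)" for v
  have max: "h' v \<le> h v \<and> E v (h' v)" for v
    unfolding h'_def
  proof (rule GreatestI_nat)
    show "0 \<le> h v \<and> E v 0" by (simp add: E_def)
    show "n \<le> h v" if "n \<le> h v \<and> E v n" for n using that by (rule conjunct1)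
  qed
  have ge: "n \<le> h' v" if "n \<le> h v" "E v n" for v n
    unfolding h'_def
  proof (rule Greatest_le_nat)
    show "n \<le> h v \<and> E v n" using that by (rule conjI)
    show "m \<le> h v" if "m \<le> h v \<and> E v m" for m using that by (rule conjunct1)
  qed
  have "reached h' x" if x: "x \<in> V" for x
  proof -
    obtain v where v: "0 < h v" "W (h v) v x" using h(2) x by blast
    then have vV: "v \<in> V" using W_in W_sym by blast
    \<comment> \<open>Every vertex has a neighbour, so truncation leaves positive radii
      positive.\<close>
    obtain w where "W 1 v w" "w \<noteq> v" using W_nontrivial vV by blast
    then have "E v 1" unfolding E_def by (auto simp: W_0)
    then have pos: "0 < h' v" using ge[of 1 v] v by auto
    \<comment> \<open>\<open>n\<close> is the distance from \<open>v\<close> to \<open>x\<close>.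
      Since \<open>x\<close> attains it, truncation does not go below \<open>n\<close>.\<close>
    define n where "n = (LEAST n. W n v x)"
    have n: "W n v x" unfolding n_def by (rule LeastI) (rule v)
    have "n \<le> h v" unfolding n_def by (rule Least_le) (rule v)
    moreover have "E v n"
      using n not_less_Least[of "n - 1" "\<lambda>n. W n v x"] unfolding E_def n_def[symmetric]
      by (cases n) auto
    ultimately have "W (h' v) v x" using ge W_mono n by blast
    then show ?thesis using pos vV unfolding reached_def supp_def by blast
  qed
  moreover have "admissible h'" using max unfolding admissible_def E_def by blast
  moreover have "sum h' V \<le> k" using h(1) max by (meson order_trans sum_mono)
  ultimately show ?thesis by blast
qed

text \<open>The ratio 5/4, written without division, is additive, so parts can be paid for
  separately.\<close>

lemma coverable_UN:
  assumes "finite I" "\<And>i. i \<in> I \<Longrightarrow> \<exists>k. 4 * k \<le> 5 * r i \<and> coverable (X i) k"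
  shows "\<exists>k. 4 * k \<le> 5 * sum r I \<and> coverable (\<Union>i\<in>I. X i) k"
  using assms
proof (induction I rule: finite_induct)
  case empty
  then show ?case using coverable_empty by auto
next
  case (insert i I)
  then obtain k l where "4 * k \<le> 5 * r i" "coverable (X i) k"
    "4 * l \<le> 5 * sum r I" "coverable (\<Union>i\<in>I. X i) l" by (metis insertCI)
  then show ?case using coverable_Un insert.hyps
    by (intro exI[of _ "k + l"]) auto
qed

end

section \<open>Maximal irredundant broadcasts\<close>

locale maximal_irredundant = ball_space +
  fixes f :: "'a \<Rightarrow> nat"
  assumes irr_f: "irr f"
    and max_f: "irr g \<Longrightarrow> (\<And>v. v \<in> V \<Longrightarrow> f v \<le> g v) \<Longrightarrow> v \<in> V \<Longrightarrow> g v = f v"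
begin

abbreviation P :: "'a set" where "P \<equiv> supp f"

abbreviation PB :: "'a \<Rightarrow> 'a set" where "PB \<equiv> pb f"

definition U :: "'a set" where "U = {u \<in> V. \<forall>z\<in>P. \<not> W (f z) z u}"

lemma finite_P: "finite P" and P_V: "v \<in> P \<Longrightarrow> v \<in> V" and P_pos: "v \<in> P \<Longrightarrow> 0 < f v"
  using finite_V by (auto simp: supp_def)

lemma PB_iff:
  assumes "v \<in> P"
  shows "x \<in> PB v \<longleftrightarrow> W (f v) v x \<and> (f v = 1 \<or> \<not> W (f v - 1) v x) \<and>
    (\<forall>z\<in>P. z \<noteq> v \<longrightarrow> \<not> W (f z) z x)"
  using pb_iff[OF assms] .

lemma PB_ne: "v \<in> P \<Longrightarrow> \<exists>x. x \<in> PB v"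
  using irr_f unfolding irr_def by blast

lemma PB_W: "x \<in> PB v \<Longrightarrow> W (f v) v x"
  unfolding pb_def by auto

lemma PB_other: "x \<in> PB v \<Longrightarrow> v \<in> P \<Longrightarrow> z \<in> P \<Longrightarrow> z \<noteq> v \<Longrightarrow> \<not> W (f z) z x"
  by (simp add: PB_iff)

lemma U_notW: "u \<in> U \<Longrightarrow> z \<in> P \<Longrightarrow> \<not> W (f z) z u"
  unfolding U_def by auto

text \<open>
  Raising \<open>f\<close> to \<open>g\<close> on \<open>X\<close>, with a private undominated vertex for each \<open>v \<in> X\<close>, must empty the
  private boundary of some \<open>z\<close> outside \<open>X\<close>.
\<close>

lemma raise:
  assumes X: "X \<subseteq> V" "X \<noteq> {}"
    and out: "\<And>v. v \<notin> X \<Longrightarrow> g v = f v"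
    and up: "\<And>v. v \<in> X \<Longrightarrow> f v < g v"
    and wit: "\<And>v. v \<in> X \<Longrightarrow> \<exists>u\<in>U. W (g v) v u \<and> (g v = 1 \<or> \<not> W (g v - 1) v u) \<and>
        (\<forall>z\<in>X. z \<noteq> v \<longrightarrow> \<not> W (g z) z u)"
  shows "\<exists>z\<in>P - X. \<forall>x\<in>PB z. \<exists>v\<in>X. W (g v) v x"
proof -
  have adm: "admissible g"
    unfolding admissible_def
  proof
    fix v assume v: "v \<in> V"
    show "g v = 0 \<or> (\<exists>u. W (g v) v u \<and> \<not> W (g v - 1) v u)"
    proof (cases "v \<in> X")
      case True
      \<comment> \<open>Needed for \<open>g v = 1\<close>, where the witness may be \<open>v\<close>
        itself.\<close>
      have "\<exists>u. W 1 v u \<and> \<not> W 0 v u"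
        using W_nontrivial[OF v] by (auto simp: W_0)
      then show ?thesis using wit[OF True] by auto
    next
      case False
      then show ?thesis using irr_f v out unfolding irr_def admissible_def by auto
    qed
  qed
  have "\<not> irr g"
  proof
    assume "irr g"
    moreover have "f v \<le> g v" for v using out up by (cases "v \<in> X") (auto simp: less_imp_le)
    ultimately have "g v = f v" if "v \<in> V" for v using max_f that by blast
    then show False using X up by (metis ex_in_conv less_irrefl subsetD)
  qed
  then obtain z where z: "z \<in> supp g" "pb g z = {}" using adm unfolding irr_def by blast
  have suppX: "supp g = P \<union> X"
  proof (intro equalityI subsetI)
    fix v assume "v \<in> supp g"
    then show "v \<in> P \<union> X" using out[of v] by (cases "v \<in> X") (auto simp: supp_def)
  next
    fix v assume "v \<in> P \<union> X"
    then show "v \<in> supp g" using out[of v] up[of v] X by (cases "v \<in> X") (auto simp: supp_def)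
  qed
  \<comment> \<open>A raised vertex keeps its undominated witness in its private boundary: no
    unchanged ball contains a vertex of \<open>U\<close>.\<close>
  have zX: "z \<notin> X"
  proof
    assume zX: "z \<in> X"
    obtain u where u: "u \<in> U" "W (g z) z u" "g z = 1 \<or> \<not> W (g z - 1) z u"
      "\<forall>y\<in>X. y \<noteq> z \<longrightarrow> \<not> W (g y) y u" using wit[OF zX] by blast
    have "\<not> W (g y) y u" if "y \<in> supp g" "y \<noteq> z" for y
      using that u U_notW out suppX by (cases "y \<in> X") auto
    then have "u \<in> pb g z" using pb_iff[OF z(1)] u by blast
    then show False using z by blast
  qed
  then have zP: "z \<in> P" using z suppX by blast
  \<comment> \<open>A private boundary vertex of \<open>z\<close> under \<open>f\<close> that every
    raised ball misses stays private under \<open>g\<close>.\<close>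
  have "\<exists>v\<in>X. W (g v) v x" if x: "x \<in> PB z" for x
  proof (rule ccontr)
    assume no: "\<not> (\<exists>v\<in>X. W (g v) v x)"
    have "\<not> W (g y) y x" if "y \<in> supp g" "y \<noteq> z" for y
      using that no out suppX x PB_other zP by (cases "y \<in> X") auto
    then have "x \<in> pb g z" using pb_iff[OF z(1)] x out[OF zX] unfolding PB_iff[OF zP] by auto
    then show False using z by blast
  qed
  then show ?thesis using zP zX by blast
qed

section \<open>Undominated vertices and the broadcasting vertices they attach to\<close>

definition bad :: "'a \<Rightarrow> 'a \<Rightarrow> bool" where
  "bad v u \<longleftrightarrow> v \<in> P \<and> u \<in> U \<and> (\<forall>x\<in>PB v. W 1 u x)"

text \<open>Raise \<open>f\<close> at \<open>u\<close> itself from 0 to 1, with \<open>u\<close> as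
  its own witness; the new ball of radius 1 must swallow some private boundary.\<close>

lemma U_bad:
  assumes u: "u \<in> U"
  shows "\<exists>v. bad v u"
proof -
  have uV: "u \<in> V" using u U_def by auto
  have f0: "f u = 0" using U_notW[OF u, of u] W_refl[OF uV] uV by (auto simp: supp_def)
  have "\<exists>z\<in>P - {u}. \<forall>x\<in>PB z. \<exists>v\<in>{u}. W ((f(u := 1)) v) v x"
  proof (rule raise)
    show "\<exists>w\<in>U. W ((f(u := 1)) v) v w \<and> ((f(u := 1)) v = 1 \<or> \<not> W ((f(u := 1)) v - 1) v w) \<and>
        (\<forall>z\<in>{u}. z \<noteq> v \<longrightarrow> \<not> W ((f(u := 1)) z) z w)" if "v \<in> {u}" for v
      using that u uV W_refl by (intro bexI[of _ u]) auto
  qed (use uV f0 in auto)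
  then show ?thesis using u unfolding bad_def by auto
qed

text \<open>Go to \<open>u\<close> through a private boundary vertex of \<open>v\<close>.\<close>

lemma bad_W:
  assumes "bad v u"
  shows "W (Suc (f v)) v u"
proof -
  obtain x where x: "x \<in> PB v" using assms PB_ne unfolding bad_def by blast
  then have "W 1 x u" using assms W_sym unfolding bad_def by blast
  then show ?thesis using W_near[OF PB_W[OF x]] by auto
qed

lemma bad_notW: "bad v u \<Longrightarrow> \<not> W (f v) v u"
  unfolding bad_def U_def by blast

text \<open>After raising \<open>v\<close> by one, \<open>u\<close> is private to \<open>v\<close>,
  so the broken private boundary belongs to another vertex.\<close>

lemma bad_raise:
  assumes "bad v u"
  shows "\<exists>z\<in>P. z \<noteq> v \<and> (\<forall>x\<in>PB z. W (Suc (f v)) v x)"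
proof -
  have vu: "v \<in> P" "u \<in> U" using assms by (auto simp: bad_def)
  have "\<exists>z\<in>P - {v}. \<forall>x\<in>PB z. \<exists>w\<in>{v}. W ((f(v := Suc (f v))) w) w x"
  proof (rule raise)
    show "\<exists>x\<in>U. W ((f(v := Suc (f v))) y) y x \<and>
        ((f(v := Suc (f v))) y = 1 \<or> \<not> W ((f(v := Suc (f v))) y - 1) y x) \<and>
        (\<forall>z\<in>{v}. z \<noteq> y \<longrightarrow> \<not> W ((f(v := Suc (f v))) z) z x)" if "y \<in> {v}" for y
      using that vu bad_W[OF assms] bad_notW[OF assms] by (intro bexI[of _ u]) auto
  qed (use vu P_V in auto)
  then show ?thesis by auto
qed

text \<open>Both vertices are raised at once. The last two hypotheses keep \<open>u\<close> and
  \<open>u'\<close> outside each other's enlarged balls, so \<open>v\<close> and \<open>w\<close>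
  stay irredundant and a third vertex fails.\<close>

lemma bad_raise2:
  assumes "bad v u" "bad w u'" "v \<noteq> w" "\<not> W (Suc (f w)) w u" "\<not> W (Suc (f v)) v u'"
  shows "\<exists>z\<in>P. z \<noteq> v \<and> z \<noteq> w \<and> (\<forall>x\<in>PB z. W (Suc (f v)) v x \<or> W (Suc (f w)) w x)"
proof -
  have U: "u \<in> U" "u' \<in> U" "v \<in> P" "w \<in> P" using assms by (auto simp: bad_def)
  define g where "g = f(v := Suc (f v), w := Suc (f w))"
  have g: "g v = Suc (f v)" "g w = Suc (f w)" using assms(3) by (auto simp: g_def)
  have "\<exists>z\<in>P - {v, w}. \<forall>x\<in>PB z. \<exists>y\<in>{v, w}. W (g y) y x"
  proof (rule raise)
    show "\<exists>x\<in>U. W (g y) y x \<and> (g y = 1 \<or> \<not> W (g y - 1) y x) \<and>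
        (\<forall>z\<in>{v, w}. z \<noteq> y \<longrightarrow> \<not> W (g z) z x)" if "y \<in> {v, w}" for y
    proof (cases "y = v")
      case True
      then show ?thesis using U assms(3,4) bad_W[OF assms(1)] bad_notW[OF assms(1)]
        by (intro bexI[of _ u]) (auto simp: g)
    next
      case False
      then show ?thesis using that U assms(3,5) bad_W[OF assms(2)] bad_notW[OF assms(2)]
        by (intro bexI[of _ u']) (auto simp: g)
    qed
  qed (use U P_V g in \<open>auto simp: g_def\<close>)
  then have "\<exists>z\<in>P - {v, w}. \<forall>x\<in>PB z. W (Suc (f v)) v x \<or> W (Suc (f w)) w x"
    using g by auto
  then show ?thesis using assms(3) by auto
qed

text \<open>Otherwise \<open>v\<close> lies in its own private boundary, so \<open>u\<close> is
  adjacent to \<open>v\<close> and hence dominated.\<close>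

lemma bad_radius_one:
  assumes "bad v u" "f v = 1"
  shows "\<exists>z\<in>P. z \<noteq> v \<and> W (f z) z v"
proof (rule ccontr)
  assume no: "\<not> ?thesis"
  have vP: "v \<in> P" using assms by (auto simp: bad_def)
  then have "v \<in> PB v" using no assms(2) W_refl P_V by (auto simp: PB_iff)
  then have "W (f v) v u" using assms W_sym by (auto simp: bad_def)
  then show False using bad_notW assms by blast
qed

section \<open>Clusters\<close>

definition R :: "'a set \<Rightarrow> nat" where "R C = sum f C"

text \<open>Two balls meet iff their centres are within \<open>f a + f b\<close>, so this is a
  component of the intersection graph. Connectivity is stated through cuts, the form in which a
  cluster can be grown one ball at a time.\<close>

definition cluster :: "'a set \<Rightarrow> bool" where
  "cluster C \<longleftrightarrow> C \<subseteq> P \<and> C \<noteq> {} \<and> (\<forall>a\<in>C. \<forall>b\<in>P - C. \<not> W (f a + f b) a b) \<and>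
    (\<forall>S. S \<noteq> {} \<longrightarrow> S \<subset> C \<longrightarrow> (\<exists>a\<in>S. \<exists>b\<in>C - S. W (f a + f b) a b))"

definition covered :: "'a set \<Rightarrow> 'a set" where
  "covered C = {x. \<exists>z\<in>C. W (f z) z x \<or> bad z x}"

definition tight :: "'a set \<Rightarrow> bool" where
  "tight C \<longleftrightarrow> (\<exists>c. \<forall>y\<in>covered C. W (R C) c y)"

text \<open>
  \<open>z\<close> will be a broadcasting vertex outside \<open>C\<close>. The first ball serves to absorb \<open>C\<close> into a group
  containing \<open>z\<close>. The last condition handles total radius \<open>2 + 1\<close>, where the budget
  leaves no room for an extra \<open>1\<close>.
\<close>

definition linked :: "'a set \<Rightarrow> 'a \<Rightarrow> bool" where
  "linked C z \<longleftrightarrow>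
    (\<forall>x\<in>PB z. \<exists>c. (\<forall>y\<in>covered C. W (R C + 1) c y) \<and> W (R C) c x \<and>
      (\<forall>t\<in>C. \<exists>y\<in>PB t. W (R C) c y)) \<and>
    (\<exists>c. \<forall>y\<in>covered C \<union> PB z. W (R C + 1) c y)"

lemma cluster_P: "cluster C \<Longrightarrow> z \<in> C \<Longrightarrow> z \<in> P"
  unfolding cluster_def by blast

lemma cluster_finite: "cluster C \<Longrightarrow> finite C"
  unfolding cluster_def using finite_P finite_subset by blast

text \<open>A common vertex \<open>x\<close> bounds the distance of the centres by
  \<open>f a + f b\<close>. Thus whatever dominates a vertex of a ball of \<open>C\<close> belongs
  to \<open>C\<close>.\<close>

lemma cluster_sep:
  assumes "cluster C" "a \<in> C" "b \<in> P" "W (f a) a x" "W (f b) b x"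
  shows "b \<in> C"
proof (rule ccontr)
  assume "b \<notin> C"
  then have "\<not> W (f a + f b) a b" using assms unfolding cluster_def by blast
  then show False using W_trans[OF assms(4) W_sym[OF assms(5)]] by blast
qed

lemma cluster_crossing:
  "cluster C \<Longrightarrow> S \<noteq> {} \<Longrightarrow> S \<subset> C \<Longrightarrow> \<exists>a\<in>S. \<exists>b\<in>C - S. W (f a + f b) a b"
  unfolding cluster_def by (elim conjE allE impE)

text \<open>Grow a connected part \<open>S\<close> and move its centre \<open>c\<close> by
  \<open>f b\<close> towards each new \<open>b\<close>: the old balls get farther by at most
  \<open>f b\<close>, and \<open>b\<close> comes within \<open>R S\<close>. In the end every ball of
  \<open>C\<close> lies in radius \<open>R C\<close> about the centre.\<close>

lemma cluster_centre:
  assumes C: "cluster C"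
  shows "\<exists>c. \<forall>z\<in>C. W (R C - f z) c z"
proof -
  have fin: "finite C" by (rule cluster_finite[OF C])
  have *: "\<exists>S\<subseteq>C. card S = n \<and> (\<exists>c. \<forall>z\<in>S. W (R S - f z) c z)"
    if "0 < n" "n \<le> card C" for n
    using that
  proof (induction n rule: nat_induct_non_zero)
    case 1
    obtain a where a: "a \<in> C" using C unfolding cluster_def by blast
    have "W 0 a a" using W_refl P_V cluster_P[OF C a] by blast
    then show ?case using a
      by (intro exI[of _ "{a}"]) (auto simp: R_def intro!: exI[of _ a])
  next
    case (Suc n)
    then obtain S c where S: "S \<subseteq> C" "card S = n" and c: "\<And>z. z \<in> S \<Longrightarrow> W (R S - f z) c z"
      by auto
    have finS: "finite S" using S fin finite_subset by blast
    have "S \<noteq> {}" "S \<subset> C" using S Suc by auto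
    then obtain a b where ab: "a \<in> S" "b \<in> C - S" "W (f a + f b) a b"
      using cluster_crossing[OF C] by meson
    have le: "f z \<le> R S" if "z \<in> S" for z
      unfolding R_def by (rule member_le_sum) (use that finS in auto)
    \<comment> \<open>The route through \<open>a\<close> has length at most
      \<open>(R S - f a) + (f a + f b)\<close>.\<close>
    have "W (f b + R S) c b"
      by (rule W_near[OF c[OF ab(1)] ab(3)]) (use le[OF ab(1)] in simp)
    then obtain c' where c': "W (f b) c c'" "W (R S) c' b" using W_split by blast
    have RS: "R (insert b S) = f b + R S" using ab finS by (simp add: R_def)
    have "W (R (insert b S) - f z) c' z" if z: "z \<in> insert b S" for z
    proof (cases "z = b")
      case True
      then show ?thesis using c' RS by simp
    next
      case False
      then have "z \<in> S" using z by simp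
      then show ?thesis using W_near[OF W_sym[OF c'(1)] c] le RS by simp
    qed
    then show ?case using ab S finS by (intro exI[of _ "insert b S"]) auto
  qed
  have "0 < card C" using C fin unfolding cluster_def by (simp add: card_gt_0_iff)
  then obtain S c where S: "S \<subseteq> C" "card S = card C" "\<forall>z\<in>S. W (R S - f z) c z"
    using *[of "card C"] by auto
  then have "S = C" using fin card_subset_eq by blast
  then show ?thesis using S by blast
qed

lemma cluster_le: "cluster C \<Longrightarrow> z \<in> C \<Longrightarrow> f z \<le> R C"
  unfolding R_def using cluster_finite by (simp add: member_le_sum)

lemma R_pos:
  assumes C: "cluster C"
  shows "0 < R C"
proof -
  obtain z where "z \<in> C" using C unfolding cluster_def by blast
  then show ?thesis using cluster_le[OF C] P_pos[OF cluster_P[OF C]] by (meson order_less_le_trans)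
qed

text \<open>This and the next two facts turn a distance bound from \<open>c\<close> to a centre
  \<open>z\<close> into arithmetic on radii.\<close>

lemma near_ball: "W n c z \<Longrightarrow> n + f z \<le> r \<Longrightarrow> W (f z) z y \<Longrightarrow> W r c y"
  by (rule W_near)

lemma near_bad: "W n c z \<Longrightarrow> n + Suc (f z) \<le> r \<Longrightarrow> bad z y \<Longrightarrow> W r c y"
  by (rule W_near[OF _ bad_W])

lemma near_PB:
  assumes "W n c z" "n + f z \<le> r" "z \<in> P"
  shows "\<exists>y\<in>PB z. W r c y"
proof -
  obtain y where "y \<in> PB z" using PB_ne[OF assms(3)] by blast
  then show ?thesis using near_ball[OF assms(1,2) PB_W] by blast
qed

lemma bad_PB: "bad z u \<Longrightarrow> x \<in> PB z \<Longrightarrow> W 1 x u"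
  using W_sym unfolding bad_def by blast

lemma covered_insert:
  "covered (insert z C) = {x. W (f z) z x \<or> bad z x} \<union> covered C"
  by (auto simp: covered_def)

lemma covered_empty: "covered {} = {}"
  by (auto simp: covered_def)

text \<open>Only the balls themselves have to be reached, and the cluster centre does that.\<close>

lemma not_bad_tight:
  assumes "cluster C" "\<And>z u. z \<in> C \<Longrightarrow> \<not> bad z u"
  shows "tight C"
proof -
  obtain c where c: "\<And>z. z \<in> C \<Longrightarrow> W (R C - f z) c z" using cluster_centre[OF assms(1)] by blast
  have "W (R C) c y" if y: "y \<in> covered C" for y
  proof -
    obtain z where z: "z \<in> C" "W (f z) z y" using y assms(2) unfolding covered_def by blast
    show ?thesis by (rule near_ball[OF c[OF z(1)] _ z(2)]) (use cluster_le[OF assms(1) z(1)] in simp)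
  qed
  then show ?thesis unfolding tight_def by blast
qed

text \<open>\<open>K\<close> collects candidate centres: the absorbing centre may depend on
  \<open>x\<close>, whereas the centre reaching all of \<open>PB z\<close> is one fixed
  \<open>c\<close>.\<close>

lemma linkedI:
  assumes "\<And>x. x \<in> PB z \<Longrightarrow> \<exists>c\<in>K. W (R C) c x"
    and "\<And>c y. c \<in> K \<Longrightarrow> y \<in> covered C \<Longrightarrow> W (R C + 1) c y"
    and "\<And>c t. c \<in> K \<Longrightarrow> t \<in> C \<Longrightarrow> \<exists>y\<in>PB t. W (R C) c y"
    and "c \<in> K" "\<And>x. x \<in> PB z \<Longrightarrow> W (R C + 1) c x"
  shows "linked C z"
  unfolding linked_def
proof (intro conjI ballI)
  fix x assume "x \<in> PB z"
  then obtain c where "c \<in> K" "W (R C) c x" using assms(1) by blast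
  then show "\<exists>c. (\<forall>y\<in>covered C. W (R C + 1) c y) \<and> W (R C) c x \<and> (\<forall>t\<in>C. \<exists>y\<in>PB t. W (R C) c y)"
    using assms(2,3) by blast
next
  show "\<exists>c. \<forall>y\<in>covered C \<union> PB z. W (R C + 1) c y" using assms(2,4,5) by blast
qed

section \<open>Clusters of total radius at most 3\<close>

text \<open>Raising \<open>v\<close> swallows \<open>PB z\<close> for some other \<open>z\<close>.
  For \<open>x\<close> in \<open>PB z\<close>, one step from \<open>v\<close> towards
  \<open>x\<close> gives the absorbing centre \<open>c\<close>.\<close>

lemma singleton_linked:
  assumes C: "cluster {v}" and u: "bad v u" and k: "2 \<le> f v"
  shows "\<exists>z\<in>P - {v}. linked {v} z"
proof -
  have vP: "v \<in> P" by (rule cluster_P[OF C]) simp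
  have R: "R {v} = f v" by (simp add: R_def)
  obtain z where z: "z \<in> P" "z \<noteq> v" "\<And>x. x \<in> PB z \<Longrightarrow> W (Suc (f v)) v x"
    using bad_raise[OF u] by blast
  have "\<exists>c. (\<forall>y\<in>covered {v}. W (f v + 1) c y) \<and> W (f v) c x \<and> (\<exists>y\<in>PB v. W (f v) c y)"
    if x: "x \<in> PB z" for x
  proof -
    have "W (1 + f v) v x" using z(3)[OF x] by simp
    then obtain c where c: "W 1 v c" "W (f v) c x" using W_split by blast
    have "W ((f v - 1) + 1) c x" using c k by simp
    \<comment> \<open>The vertex just before \<open>x\<close> is at distance exactly
      \<open>f v\<close> from \<open>v\<close>. No other ball meets that of \<open>v\<close>, so
      \<open>y\<close> is in \<open>PB v\<close> and adjacent to all undominated vertices attached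
      to \<open>v\<close>.\<close>
    then obtain y where y: "W (f v - 1) c y" "W 1 y x" using W_split by blast
    have vy: "W (f v) v y" using W_near[OF c(1) y(1)] k by simp
    have notx: "\<not> W (f v) v x" using PB_other[OF x z(1) vP] z(2) by blast
    have "\<not> W (f v - 1) v y"
    proof
      assume "W (f v - 1) v y"
      then have "W (f v) v x" using W_near[OF _ y(2)] k by auto
      then show False using notx by blast
    qed
    moreover have "\<not> W (f z') z' y" if "z' \<in> P" "z' \<noteq> v" for z'
      using cluster_sep[OF C _ that(1) vy] that by auto
    ultimately have yPB: "y \<in> PB v" using vy PB_iff[OF vP] by blast
    have cy: "W (f v) c y" using W_mono[OF y(1)] by simp
    have "W (f v + 1) c w" if "w \<in> covered {v}" for w
      using that near_ball[OF W_sym[OF c(1)], of "f v + 1" w] W_near[OF cy bad_PB[OF _ yPB], of w "f v + 1"]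
      by (auto simp: covered_insert covered_empty)
    then show ?thesis using c cy yPB by blast
  qed
  moreover have "W (f v + 1) v y" if "y \<in> covered {v} \<union> PB z" for y
    using that z(3) bad_W[of v y] W_mono[of "f v" v y "f v + 1"]
    by (auto simp: covered_insert covered_empty)
  ultimately show ?thesis using z unfolding linked_def R by blast
qed

text \<open>The centres are adjacent. Radius 2 about \<open>v\<close> can only miss undominated
  vertices attached to \<open>w\<close>, and vice versa; if both centres fail, raising both yields
  the link.\<close>

lemma pair_one_one:
  assumes C: "cluster {v, w}" and vw: "v \<noteq> w" "f v = 1" "f w = 1" and u: "bad v u"
  shows "tight {v, w} \<or> (\<exists>z\<in>P - {v, w}. linked {v, w} z)"
proof -
  have PP: "v \<in> P" "w \<in> P" using cluster_P[OF C] by auto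
  have R: "R {v, w} = 2" using vw by (simp add: R_def)
  obtain z where z: "z \<in> P" "z \<noteq> v" "W (f z) z v" using bad_radius_one[OF u vw(2)] by blast
  have "z \<in> {v, w}" by (rule cluster_sep[OF C _ z(1) _ z(3), of v]) (auto intro: W_refl P_V PP)
  then have wv: "W 1 w v" using z vw by simp
  have vw1: "W 1 v w" by (rule W_sym[OF wv])
  have rv: "W 0 v v" "W 0 w w" using W_refl P_V PP by auto
  show ?thesis
  proof (cases "\<forall>u'. bad w u' \<longrightarrow> W 2 v u'")
    case True
    have "W 2 v y" if "y \<in> covered {v, w}" for y
      using that True near_ball[OF rv(1), of 2 y] near_bad[OF rv(1), of 2 y] near_ball[OF vw1, of 2 y] vw
      by (auto simp: covered_insert covered_empty)
    then show ?thesis unfolding tight_def R by blast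
  next
    case u': False
    show ?thesis
    proof (cases "\<forall>u. bad v u \<longrightarrow> W 2 w u")
      case True
      have "W 2 w y" if "y \<in> covered {v, w}" for y
        using that True near_ball[OF rv(2), of 2 y] near_bad[OF rv(2), of 2 y] near_ball[OF wv, of 2 y] vw
        by (auto simp: covered_insert covered_empty)
      then show ?thesis unfolding tight_def R by blast
    next
      case False
      then obtain u u' where uu: "bad v u" "bad w u'" "\<not> W 2 w u" "\<not> W 2 v u'" using u' by blast
      obtain z where z: "z \<in> P" "z \<noteq> v" "z \<noteq> w" "\<And>x. x \<in> PB z \<Longrightarrow> W 2 v x \<or> W 2 w x"
        using bad_raise2[OF uu(1,2) vw(1)] uu(3,4) vw by (auto simp: numeral_2_eq_2)
      have cov: "W 3 v y" if "y \<in> covered {v, w}" for y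
        using that near_ball[OF rv(1), of 3 y] near_bad[OF rv(1), of 3 y]
          near_ball[OF vw1, of 3 y] near_bad[OF vw1, of 3 y] vw
        by (auto simp: covered_insert covered_empty)
      have cov': "W 3 w y" if "y \<in> covered {v, w}" for y
        using that near_ball[OF rv(2), of 3 y] near_bad[OF rv(2), of 3 y]
          near_ball[OF wv, of 3 y] near_bad[OF wv, of 3 y] vw
        by (auto simp: covered_insert covered_empty)
      have pb: "\<exists>y\<in>PB t. W 2 c y" if "t \<in> {v, w}" "c \<in> {v, w}" for t c
        using that near_PB[OF rv(1), of 2] near_PB[OF rv(2), of 2] near_PB[OF vw1, of 2]
          near_PB[OF wv, of 2] PP vw by auto
      have "W 3 v x" if "x \<in> PB z" for x
        using z(4)[OF that] W_mono[of 2 v x 3] W_near[OF vw1, of 2 x 3] by auto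
      then have "linked {v, w} z"
        by (intro linkedI[of z "{v, w}" _ v]) (use z(4) cov cov' pb in \<open>auto simp: R\<close>)
      then show ?thesis using z by blast
    qed
  qed
qed

text \<open>At distance at most 2, the candidate centres are \<open>s\<close> and a vertex
  \<open>q\<close> within 1 of both; if both fail, \<open>s\<close> and \<open>t\<close> are raised
  together. At distance 3, \<open>t\<close> is not bad and only \<open>s\<close> is raised.\<close>

lemma pair_two_one:
  assumes C: "cluster {s, t}" and st: "s \<noteq> t" "f s = 2" "f t = 1"
  shows "tight {s, t} \<or> (\<exists>z\<in>P - {s, t}. linked {s, t} z)"
proof -
  have PP: "s \<in> P" "t \<in> P" using cluster_P[OF C] by auto
  have R: "R {s, t} = 3" using st by (simp add: R_def)
  have r: "W 0 s s" "W 0 t t" using W_refl P_V PP by auto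
  have tbad: "W 2 s t" if t: "bad t u" for u
  proof -
    obtain z where z: "z \<in> P" "z \<noteq> t" "W (f z) z t" using bad_radius_one[OF t st(3)] by blast
    have "z \<in> {s, t}" by (rule cluster_sep[OF C _ z(1) _ z(3), of t]) (auto intro: W_refl P_V PP)
    then show ?thesis using z st by auto
  qed
  have tight_s: "tight {s, t}"
    if "\<And>y. W (f t) t y \<Longrightarrow> W 3 s y" "\<And>y. bad t y \<Longrightarrow> W 3 s y"
  proof -
    have "W 3 s y" if "y \<in> covered {s, t}" for y
      using that \<open>\<And>y. W (f t) t y \<Longrightarrow> W 3 s y\<close> \<open>\<And>y. bad t y \<Longrightarrow> W 3 s y\<close>
        near_ball[OF r(1), of 3 y] near_bad[OF r(1), of 3 y] st
      by (auto simp: covered_insert covered_empty)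
    then show ?thesis unfolding tight_def R by blast
  qed
  show ?thesis
  proof (cases "W 2 s t")
    case st2: True
    then have "W (1 + 1) s t" by (simp add: numeral_2_eq_2)
    then obtain q where q: "W 1 s q" "W 1 q t" using W_split by blast
    have qs: "W 1 q s" by (rule W_sym[OF q(1)])
    show ?thesis
    proof (cases "\<forall>u. bad t u \<longrightarrow> W 3 s u")
      case True
      show ?thesis by (rule disjI1, rule tight_s) (use True near_ball[OF st2] st in auto)
    next
      case ubad: False
      show ?thesis
      proof (cases "\<forall>u. bad s u \<longrightarrow> W 2 t u")
        case True
        \<comment> \<open>Undominated vertices attached to \<open>s\<close> are reached through
          \<open>t\<close>, at cost 1 + 2.\<close>
        have "W 3 q y" if "y \<in> covered {s, t}" for y
          using that True near_ball[OF qs, of 3 y] W_near[OF q(2), of 2 y 3]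
            near_ball[OF q(2), of 3 y] near_bad[OF q(2), of 3 y] st
          by (auto simp: covered_insert covered_empty)
        then show ?thesis unfolding tight_def R by blast
      next
        case False
        then obtain u u' where uu: "bad s u" "bad t u'" "\<not> W 2 t u" "\<not> W 3 s u'" using ubad by blast
        obtain z where z: "z \<in> P" "z \<noteq> s" "z \<noteq> t" "\<And>x. x \<in> PB z \<Longrightarrow> W 3 s x \<or> W 2 t x"
          using bad_raise2[OF uu(1,2) st(1)] uu(3,4) st by (auto simp: numeral_2_eq_2 numeral_3_eq_3)
        have cov: "W 4 s y" if "y \<in> covered {s, t}" for y
          using that near_ball[OF r(1), of 4 y] near_bad[OF r(1), of 4 y]
            near_ball[OF st2, of 4 y] near_bad[OF st2, of 4 y] st
          by (auto simp: covered_insert covered_empty)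
        have cov': "W 4 q y" if "y \<in> covered {s, t}" for y
          using that near_ball[OF qs, of 4 y] near_bad[OF qs, of 4 y]
            near_ball[OF q(2), of 4 y] near_bad[OF q(2), of 4 y] st
          by (auto simp: covered_insert covered_empty)
        have pb: "\<exists>y\<in>PB a. W 3 c y" if "a \<in> {s, t}" "c \<in> {s, q}" for a c
          using that near_PB[OF r(1), of 3] near_PB[OF qs, of 3] near_PB[OF st2, of 3]
            near_PB[OF q(2), of 3] PP st by auto
        have z4: "W 4 s x" if "x \<in> PB z" for x
          using z(4)[OF that] W_mono[of 3 s x 4] W_near[OF st2, of 2 x 4] by auto
        have "\<exists>c\<in>{s, q}. W 3 c x" if "x \<in> PB z" for x
          using z(4)[OF that] W_near[OF q(2), of 2 x 3] by auto
        then have "linked {s, t} z"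
          by (intro linkedI[of z "{s, q}" _ s]) (use z4 cov cov' pb in \<open>auto simp: R\<close>)
        then show ?thesis using z by blast
      qed
    qed
  next
    case nst2: False
    have st3: "W 3 s t"
    proof -
      have "\<exists>a\<in>{s}. \<exists>b\<in>{s, t} - {s}. W (f a + f b) a b"
        by (rule cluster_crossing[OF C]) (use st in auto)
      then show ?thesis using st by (auto simp: numeral_3_eq_3)
    qed
    have ntb: "\<not> bad t u" for u using tbad nst2 by blast
    show ?thesis
    proof (cases "\<exists>u. bad s u")
      case False
      then show ?thesis using not_bad_tight[OF C] ntb by blast
    next
      case True
      then obtain u where u: "bad s u" by blast
      obtain z where z: "z \<in> P" "z \<noteq> s" "\<And>x. x \<in> PB z \<Longrightarrow> W 3 s x"
        using bad_raise[OF u] st by (auto simp: numeral_3_eq_3)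
      show ?thesis
      proof (cases "z = t")
        case True
        \<comment> \<open>Private boundary vertices of \<open>t\<close> are swallowed by the raised
          ball of \<open>s\<close>; any other vertex of the ball of \<open>t\<close> also lies in
          the ball of \<open>s\<close>.\<close>
        have "W 3 s y" if y: "W (f t) t y" for y
        proof (cases "y \<in> PB t")
          case False
          then obtain b where b: "b \<in> P" "b \<noteq> t" "W (f b) b y" using y st PB_iff[OF PP(2)] by blast
          have "b \<in> {s, t}" by (rule cluster_sep[OF C _ b(1) y b(3)]) simp
          then show ?thesis using b st W_mono by auto
        qed (use z(3) True in auto)
        then show ?thesis using tight_s ntb by blast
      next
        case False
        have cov: "W 4 s y" if "y \<in> covered {s, t}" for y
          using that near_ball[OF r(1), of 4 y] near_bad[OF r(1), of 4 y] near_ball[OF st3, of 4 y] ntb st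
          by (auto simp: covered_insert covered_empty)
        \<comment> \<open>An arbitrary vertex of \<open>PB t\<close> could be at distance 4 from
          \<open>s\<close>; \<open>t\<close> itself is at distance 3 and is private, as
          \<open>s\<close> does not reach it.\<close>
        have "t \<in> PB t"
        proof -
          have "\<not> W (f b) b t" if "b \<in> P" "b \<noteq> t" for b
            using cluster_sep[OF C, of t b t] that nst2 st W_refl P_V PP by auto
          then show ?thesis using st W_refl P_V PP by (auto simp: PB_iff)
        qed
        then have pb: "\<exists>y\<in>PB a. W 3 s y" if "a \<in> {s, t}" for a
          using that near_PB[OF r(1), of 3] st3 PP st by auto
        have "W 4 s x" if "x \<in> PB z" for x using z(3)[OF that] W_mono by force
        then have "linked {s, t} z"
          by (intro linkedI[of z "{s}" _ s]) (use z(3) cov pb in \<open>auto simp: R\<close>)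
        then show ?thesis using z False by blast
      qed
    qed
  qed
qed

lemma bad_radius_one_cluster:
  assumes C: "cluster C" and v: "v \<in> C" "bad v u" "f v = 1"
  shows "\<exists>z\<in>C. z \<noteq> v \<and> W (f z) z v"
proof -
  obtain z where z: "z \<in> P" "z \<noteq> v" "W (f z) z v" using bad_radius_one[OF v(2,3)] by blast
  have "z \<in> C" by (rule cluster_sep[OF C v(1) z(1) _ z(3)]) (intro W_refl P_V cluster_P[OF C v(1)])
  then show ?thesis using z by blast
qed

text \<open>Both \<open>v\<close> and \<open>w\<close> are within 1 of each other, so radius 3 about
  either handles them. The choice between them is made by closeness to \<open>t\<close>, which is
  adjacent to one of them if bad and within 2 of one otherwise.\<close>

lemma triple_tight:
  assumes C: "cluster {v, w, t}" and d: "t \<noteq> v" "t \<noteq> w" "v \<noteq> w"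
    and f: "f v = 1" "f w = 1" "f t = 1" and vw: "W 1 v w"
  shows "tight {v, w, t}"
proof -
  have R: "R {v, w, t} = 3" using d f by (simp add: R_def)
  have PP: "v \<in> P" "w \<in> P" "t \<in> P" using cluster_P[OF C] by auto
  have "\<exists>c\<in>{v, w}. W 1 c t \<or> W 2 c t \<and> (\<forall>u. \<not> bad t u)"
  proof (cases "\<exists>u. bad t u")
    case True
    then obtain u where u: "bad t u" by blast
    obtain z where "z \<in> {v, w, t}" "z \<noteq> t" "W (f z) z t"
      using bad_radius_one_cluster[OF C _ u f(3)] by blast
    then show ?thesis using f by auto
  next
    case False
    have "\<exists>a\<in>{t}. \<exists>b\<in>{v, w, t} - {t}. W (f a + f b) a b"
      by (rule cluster_crossing[OF C]) (use d in auto)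
    then obtain b where b: "b \<in> {v, w}" "W (f t + f b) t b" by blast
    then have "W 2 t b" using f by (auto simp: numeral_2_eq_2)
    then show ?thesis using False W_sym b(1) by blast
  qed
  then obtain c where c: "c \<in> {v, w}" "W 1 c t \<or> W 2 c t \<and> (\<forall>u. \<not> bad t u)" by blast
  have cv: "W 1 c v" "W 1 c w" using c(1) vw W_sym[OF vw] W_refl P_V PP by auto
  have "W 3 c y" if "y \<in> covered {v, w, t}" for y
    using that c(2) near_ball[OF cv(1), of 3 y] near_bad[OF cv(1), of 3 y] near_ball[OF cv(2), of 3 y]
      near_bad[OF cv(2), of 3 y] near_ball[of 1 c t 3 y] near_bad[of 1 c t 3 y]
      near_ball[of 2 c t 3 y] f
    by (auto simp: covered_insert covered_empty)
  then show ?thesis unfolding tight_def R by blast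
qed

lemma card_le_R:
  assumes C: "cluster C"
  shows "card C \<le> R C"
proof -
  have "card C = (\<Sum>v\<in>C. 1)" by simp
  also have "\<dots> \<le> sum f C" by (rule sum_mono) (use P_pos cluster_P[OF C] in \<open>auto simp: Suc_le_eq\<close>)
  finally show ?thesis unfolding R_def .
qed

text \<open>A cluster that is not tight has a bad vertex and at most three centres, which leaves the
  cases above. The bound \<open>2 \<le> R C\<close> leaves 2 + 1 as the only merged total below
  4.\<close>

lemma small_cluster:
  assumes C: "cluster C" and R: "R C \<le> 3" and nt: "\<not> tight C"
  shows "2 \<le> R C \<and> (\<exists>z\<in>P - C. linked C z)"
proof -
  obtain v u where v: "v \<in> C" "bad v u" using not_bad_tight[OF C] nt by blast
  have fin: "finite C" by (rule cluster_finite[OF C])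
  have pos: "0 < f z" if "z \<in> C" for z using P_pos cluster_P[OF C that] by blast
  have "card C \<le> 3" using card_le_R[OF C] R by simp
  moreover have "0 < card C" using v fin card_gt_0_iff by blast
  ultimately consider "card (C - {v}) = 0" | "card (C - {v}) = 1" | "card (C - {v}) = 2"
    using card_Diff_singleton[OF v(1)] by linarith
  then show ?thesis
  proof cases
    case 1
    then have "C - {v} = {}" using fin by (simp only: card_0_eq finite_Diff)
    then have Cv: "C = {v}" using v by auto
    \<comment> \<open>A bad vertex of radius 1 is dominated by another centre of its
      cluster.\<close>
    have "f v \<noteq> 1" using bad_radius_one_cluster[OF C v] Cv by auto
    then have "2 \<le> f v" using pos[OF v(1)] by simp
    then show ?thesis using singleton_linked C v Cv by (auto simp: R_def)
  next
    case 2
    then obtain w where "C - {v} = {w}" using card_1_singletonE by blast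
    then have w: "C = {v, w}" "v \<noteq> w" using v by auto
    have "f v + f w \<le> 3" "0 < f v" "0 < f w" using R w pos by (auto simp: R_def)
    then consider "f v = 1" "f w = 1" | "f v = 2" "f w = 1" | "f v = 1" "f w = 2" by linarith
    then have "\<exists>z\<in>P - C. linked C z"
    proof cases
      case 1
      then show ?thesis using pair_one_one[of v w u] C v w nt by auto
    next
      case 2
      then show ?thesis using pair_two_one[of v w] C w nt by auto
    next
      case 3
      then show ?thesis using pair_two_one[of w v] C w nt by (auto simp: insert_commute)
    qed
    then show ?thesis using w card_le_R[OF C] by auto
  next
    case 3
    then have card: "card C = 3" using v fin by simp
    have f1: "f z = 1" if z: "z \<in> C" for z
    proof -
      have "card (C - {z}) \<le> sum f (C - {z})"
        using sum_mono[of "C - {z}" "\<lambda>_. 1::nat" f] pos by (auto simp: Suc_le_eq)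
      moreover have "R C = f z + sum f (C - {z})" unfolding R_def using fin z by (rule sum.remove)
      ultimately show ?thesis using card z fin R pos[OF z] by simp
    qed
    obtain w where w: "w \<in> C" "w \<noteq> v" "W (f w) w v"
      using bad_radius_one_cluster[OF C v f1[OF v(1)]] by blast
    have "card (C - {v} - {w}) = 1" using 3 w fin by simp
    then obtain t where "C - {v} - {w} = {t}" using card_1_singletonE by blast
    then have t: "C = {v, w, t}" "t \<noteq> v" "t \<noteq> w" using v w by auto
    have "tight C"
      unfolding t(1) by (rule triple_tight) (use C t w f1 W_sym in auto)
    then show ?thesis using nt by simp
  qed
qed

section \<open>Merging linked clusters\<close>

text \<open>
  One ball with a single unit of excess covers the group; the second conjunct keeps a vertex of
  each private boundary one unit inside, so that further linked clusters can be absorbed.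
\<close>

definition mergeable :: "'a set set \<Rightarrow> bool" where
  "mergeable \<S> \<longleftrightarrow> (\<exists>c. (\<forall>C\<in>\<S>. \<forall>y\<in>covered C. W (sum R \<S> + 1) c y) \<and>
    (\<forall>t\<in>\<Union>\<S>. \<exists>y\<in>PB t. W (sum R \<S>) c y))"

text \<open>The cluster centre works; the excess 1 reaches the undominated vertices.\<close>

lemma mergeable_singleton:
  assumes C: "cluster C"
  shows "mergeable {C}"
proof -
  obtain c where c: "\<And>z. z \<in> C \<Longrightarrow> W (R C - f z) c z" using cluster_centre[OF C] by blast
  have "W (R C + 1) c y" if y: "y \<in> covered C" for y
  proof -
    obtain z where z: "z \<in> C" "W (f z) z y \<or> bad z y" using y unfolding covered_def by blast
    then show ?thesis
      using near_ball[OF c[OF z(1)], of "R C + 1" y] near_bad[OF c[OF z(1)], of "R C + 1" y]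
        cluster_le[OF C z(1)] by auto
  qed
  moreover have "\<exists>y\<in>PB t. W (R C) c y" if "t \<in> C" for t
    using near_PB[OF c[OF that]] cluster_P[OF C that] cluster_le[OF C that] by simp
  ultimately show ?thesis unfolding mergeable_def by auto
qed

text \<open>The old centre \<open>c\<close> and the linking centre \<open>c'\<close> meet at
  \<open>x\<close> in \<open>PB z\<close>, so they are within \<open>R C + \<rho>\<close>. A point
  \<open>m\<close> splitting this distance extends both balls to radius
  \<open>R C + \<rho> + 1\<close>: the excess is shared, not doubled.\<close>

lemma mergeable_absorb:
  assumes fin: "finite \<S>" and S: "mergeable \<S>" and C: "C \<notin> \<S>" "linked C z" and z: "z \<in> \<Union>\<S>"
  shows "mergeable (insert C \<S>)"
proof -
  define \<rho> where "\<rho> = sum R \<S>"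
  have sum: "sum R (insert C \<S>) = R C + \<rho>" using fin C by (simp add: \<rho>_def)
  obtain c where c: "\<And>C y. C \<in> \<S> \<Longrightarrow> y \<in> covered C \<Longrightarrow> W (\<rho> + 1) c y"
    "\<And>t. t \<in> \<Union>\<S> \<Longrightarrow> \<exists>y\<in>PB t. W \<rho> c y"
    using S unfolding mergeable_def \<rho>_def by blast
  obtain x where x: "x \<in> PB z" "W \<rho> c x" using c(2)[OF z] by blast
  obtain c' where c': "\<And>y. y \<in> covered C \<Longrightarrow> W (R C + 1) c' y" "W (R C) c' x"
    "\<And>t. t \<in> C \<Longrightarrow> \<exists>y\<in>PB t. W (R C) c' y"
    using C(2) x(1) unfolding linked_def by blast
  have "W (R C + \<rho>) c c'" by (rule W_near[OF x(2) W_sym[OF c'(2)]]) simp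
  then obtain m where m: "W (R C) m c" "W \<rho> m c'" using W_split W_sym by blast
  show ?thesis unfolding mergeable_def sum
  proof (intro exI[of _ m] conjI ballI)
    fix D y assume D: "D \<in> insert C \<S>" and y: "y \<in> covered D"
    show "W (R C + \<rho> + 1) m y"
    proof (cases "D = C")
      case True
      then show ?thesis using W_near[OF m(2) c'(1)] y by simp
    next
      case False
      then show ?thesis using W_near[OF m(1) c(1)] y D by simp
    qed
  next
    fix t assume t: "t \<in> \<Union> (insert C \<S>)"
    show "\<exists>y\<in>PB t. W (R C + \<rho>) m y"
    proof (cases "t \<in> C")
      case True
      then obtain y where "y \<in> PB t" "W (R C) c' y" using c'(3) by blast
      then show ?thesis using W_near[OF m(2), of "R C" y "R C + \<rho>"] by auto
    next
      case False
      then obtain y where "y \<in> PB t" "W \<rho> c y" using c(2) t by blast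
      then show ?thesis using W_near[OF m(1), of \<rho> y "R C + \<rho>"] by auto
    qed
  qed
qed

lemma mergeable_coverable:
  assumes "mergeable \<S>" "4 \<le> sum R \<S>"
  shows "\<exists>k. 4 * k \<le> 5 * sum R \<S> \<and> coverable (\<Union>C\<in>\<S>. covered C) k"
proof -
  obtain c where c: "\<And>y. y \<in> (\<Union>C\<in>\<S>. covered C) \<Longrightarrow> W (sum R \<S> + 1) c y"
    using assms(1) unfolding mergeable_def by blast
  have "coverable (\<Union>C\<in>\<S>. covered C) (sum R \<S> + 1)" by (rule coverable_ball[OF c]) simp_all
  then show ?thesis using assms(2) by (intro exI[of _ "sum R \<S> + 1"]) simp
qed

text \<open>Such a cluster is one isolated ball without attached undominated vertices, so its whole
  ball is private. A ball containing \<open>PB z\<close> therefore covers it entirely.\<close>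

lemma covered_radius_one:
  assumes C: "cluster C" and R: "R C = 1" and z: "z \<in> C"
  shows "covered C \<subseteq> PB z"
proof -
  have "card C \<noteq> 0" using z cluster_finite[OF C] by (auto simp only: card_0_eq)
  then have "card C = 1" using card_le_R[OF C] R by linarith
  then obtain z' where "C = {z'}" by (rule card_1_singletonE)
  then have Cz: "C = {z}" using z by simp
  then have fz: "f z = 1" using R by (simp add: R_def)
  have nb: "\<not> bad z u" for u using bad_radius_one_cluster[OF C z _ fz] Cz by blast
  show ?thesis
  proof
    fix y assume "y \<in> covered C"
    then have y: "W (f z) z y" using nb Cz by (auto simp: covered_def)
    have "\<not> W (f b) b y" if "b \<in> P" "b \<noteq> z" for b
      using cluster_sep[OF C z that(1) y] that Cz by blast
    then show "y \<in> PB z" using y fz cluster_P[OF C z] by (auto simp: PB_iff)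
  qed
qed

text \<open>Induction on the family. If no small cluster needs a link, each cluster pays for itself;
  otherwise a small cluster and its link target seed a group that is removed as a whole.\<close>

lemma clusters_coverable:
  assumes "finite \<D>" "\<And>C. C \<in> \<D> \<Longrightarrow> cluster C"
    and "\<And>C. C \<in> \<D> \<Longrightarrow> R C \<le> 3 \<Longrightarrow> \<not> tight C \<Longrightarrow> \<exists>z\<in>\<Union>\<D> - C. linked C z"
  shows "\<exists>k. 4 * k \<le> 5 * sum R \<D> \<and> coverable (\<Union>C\<in>\<D>. covered C) k"
  using assms
proof (induction \<D> rule: finite_psubset_induct)
  case (psubset \<D>)
  note cl = psubset.prems(1) and link = psubset.prems(2)
  show ?case
  proof (cases "\<exists>C\<in>\<D>. R C \<le> 3 \<and> \<not> tight C")
    case False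
    show ?thesis
    proof (rule coverable_UN[OF psubset.hyps(1)])
      fix C assume C: "C \<in> \<D>"
      show "\<exists>k. 4 * k \<le> 5 * R C \<and> coverable (covered C) k"
      proof (cases "tight C")
        case True
        then obtain c where c: "\<And>y. y \<in> covered C \<Longrightarrow> W (R C) c y" unfolding tight_def by blast
        have "coverable (covered C) (R C)" by (rule coverable_ball[OF c R_pos[OF cl[OF C]]])
        then show ?thesis by (intro exI[of _ "R C"]) simp
      next
        case nt: False
        then have "4 \<le> R C" using False C by force
        then show ?thesis using mergeable_coverable[OF mergeable_singleton[OF cl[OF C]]] by simp
      qed
    qed
  next
    case True
    then obtain C where C: "C \<in> \<D>" "R C \<le> 3" "\<not> tight C" by blast
    obtain z where z: "z \<in> \<Union>\<D>" "z \<notin> C" "linked C z" using link[OF C] by blast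
    then obtain C' where C': "C' \<in> \<D>" "z \<in> C'" "C' \<noteq> C" by blast
    have R2: "2 \<le> R C" using small_cluster[OF cl[OF C(1)] C(2,3)] by simp
    \<comment> \<open>Removing a maximal group keeps the hypothesis: no remaining cluster is linked into it.\<close>
    define F where "F = {\<S>. {C, C'} \<subseteq> \<S> \<and> \<S> \<subseteq> \<D> \<and> mergeable \<S>}"
    have "{C, C'} \<in> F"
      using mergeable_absorb[OF _ mergeable_singleton[OF cl[OF C'(1)]], of C z] C C' z(3) by (auto simp: F_def)
    moreover have "finite F" unfolding F_def using psubset.hyps(1)
      by (auto intro: finite_subset[of _ "Pow \<D>"])
    ultimately obtain \<S> where S: "\<S> \<in> F" and max: "\<And>\<T>. \<T> \<in> F \<Longrightarrow> \<S> \<subseteq> \<T> \<Longrightarrow> \<T> = \<S>"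
      using finite_has_maximal[of F] by (metis empty_iff)
    have S': "{C, C'} \<subseteq> \<S>" "\<S> \<subseteq> \<D>" "mergeable \<S>" using S by (auto simp: F_def)
    have finS: "finite \<S>" using S'(2) psubset.hyps(1) finite_subset by blast
    have covS: "\<exists>k. 4 * k \<le> 5 * sum R \<S> \<and> coverable (\<Union>C\<in>\<S>. covered C) k"
    proof (cases "4 \<le> sum R \<S>")
      case True
      then show ?thesis using mergeable_coverable S'(3) by blast
    next
      case False
      \<comment> \<open>Two clusters of total radius at least 2 and 1 are present, so a total below
        4 is exactly 2 + 1 with nothing else.\<close>
      have S_split: "sum R \<S> = R C + (R C' + sum R (\<S> - {C} - {C'}))"
        using finS S'(1) C'(3) by (simp add: sum.remove[of \<S> C] sum.remove[of "\<S> - {C}" C'])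
      then have R: "R C = 2" "R C' = 1" and rest: "sum R (\<S> - {C} - {C'}) = 0"
        using False R2 R_pos[OF cl[OF C'(1)]] by auto
      have "\<S> - {C} - {C'} = {}"
      proof (rule ccontr)
        assume "\<not> ?thesis"
        then obtain D where "D \<in> \<S> - {C} - {C'}" by blast
        then show False using rest finS S'(2) R_pos[OF cl, of D] by auto
      qed
      then have SC: "\<S> = {C, C'}" using S'(1) by blast
      \<comment> \<open>Radius 3 equals the total radius here, so no excess is paid.\<close>
      obtain c where "\<And>y. y \<in> covered C \<union> PB z \<Longrightarrow> W (R C + 1) c y"
        using z(3) unfolding linked_def by blast
      then have "coverable (\<Union>C\<in>\<S>. covered C) (R C + 1)"
        using covered_radius_one[OF cl[OF C'(1)] R(2) C'(2)] SC by (intro coverable_ball[of _ _ c]) auto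
      then show ?thesis using SC R C'(3) by (intro exI[of _ "R C + 1"]) auto
    qed
    have "\<D> - \<S> \<subset> \<D>" using S' by blast
    then have "\<exists>k. 4 * k \<le> 5 * sum R (\<D> - \<S>) \<and> coverable (\<Union>C\<in>\<D> - \<S>. covered C) k"
    proof (rule psubset.IH)
      show "cluster D" if "D \<in> \<D> - \<S>" for D using cl that by blast
      show "\<exists>z\<in>\<Union> (\<D> - \<S>) - D. linked D z" if D: "D \<in> \<D> - \<S>" "R D \<le> 3" "\<not> tight D" for D
      proof -
        obtain x where x: "x \<in> \<Union>\<D>" "x \<notin> D" "linked D x" using link[of D] D by blast
        \<comment> \<open>A link into the group would let \<open>D\<close> be absorbed, against
          maximality.\<close>
        have "x \<notin> \<Union>\<S>"
        proof
          assume "x \<in> \<Union>\<S>"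
          then have "insert D \<S> \<in> F"
            using mergeable_absorb[OF finS S'(3) _ x(3)] S' D by (auto simp: F_def)
          then show False using max[of "insert D \<S>"] D by blast
        qed
        then show ?thesis using x by blast
      qed
    qed
    then obtain k l where kl: "4 * k \<le> 5 * sum R (\<D> - \<S>)" "coverable (\<Union>C\<in>\<D> - \<S>. covered C) k"
      "4 * l \<le> 5 * sum R \<S>" "coverable (\<Union>C\<in>\<S>. covered C) l" using covS by blast
    have "sum R \<D> = sum R (\<D> - \<S>) + sum R \<S>"
      by (rule sum.subset_diff[OF S'(2) psubset.hyps(1)])
    moreover have "coverable (\<Union>C\<in>\<D>. covered C) (k + l)"
      by (rule coverable_mono[OF coverable_Un[OF kl(2,4)]]) blast
    ultimately show ?thesis using kl by (intro exI[of _ "k + l"]) auto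
  qed
qed

section \<open>Partition of the broadcasting vertices into clusters\<close>

definition overlap :: "('a \<times> 'a) set" where
  "overlap = {(a, b). a \<in> P \<and> b \<in> P \<and> W (f a + f b) a b}"

lemma overlap_rtrancl_P: "(a, b) \<in> overlap\<^sup>* \<Longrightarrow> a \<in> P \<Longrightarrow> b \<in> P"
  by (induction rule: rtrancl_induct) (auto simp: overlap_def)

lemma sym_overlap: "sym (overlap\<^sup>*)"
  by (rule sym_rtrancl) (auto simp: sym_def overlap_def add.commute intro: W_sym)

lemma cluster_overlap_class:
  assumes v: "v \<in> P"
  shows "cluster (overlap\<^sup>* `` {v})"
  unfolding cluster_def
proof (intro conjI ballI allI impI)
  show "overlap\<^sup>* `` {v} \<subseteq> P" using overlap_rtrancl_P v by blast
  show "overlap\<^sup>* `` {v} \<noteq> {}" by blast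
  show "\<not> W (f a + f b) a b" if a: "a \<in> overlap\<^sup>* `` {v}" and b: "b \<in> P - overlap\<^sup>* `` {v}" for a b
  proof
    assume ab: "W (f a + f b) a b"
    have va: "(v, a) \<in> overlap\<^sup>*" using a by simp
    have "(a, b) \<in> overlap"
      unfolding overlap_def using overlap_rtrancl_P[OF va v] b ab by simp
    then have "(v, b) \<in> overlap\<^sup>*" by (rule rtrancl_into_rtrancl[OF va])
    then show False using b by simp
  qed
  show "\<exists>a\<in>S. \<exists>b\<in>overlap\<^sup>* `` {v} - S. W (f a + f b) a b"
    if S: "S \<noteq> {}" "S \<subset> overlap\<^sup>* `` {v}" for S
  proof (rule ccontr)
    assume no: "\<not> ?thesis"
    obtain a b where a: "a \<in> S" and b: "b \<in> overlap\<^sup>* `` {v}" "b \<notin> S" using S by blast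
    have "(v, a) \<in> overlap\<^sup>*" using a S by blast
    then have "(a, v) \<in> overlap\<^sup>*" by (rule symD[OF sym_overlap])
    moreover have "(v, b) \<in> overlap\<^sup>*" using b by simp
    ultimately have "(a, b) \<in> overlap\<^sup>*" by (rule rtrancl_trans)
    \<comment> \<open>If no overlap crosses the cut, a path starting in \<open>S\<close> stays in
      \<open>S\<close>.\<close>
    then have "b \<in> S"
    proof (induction rule: rtrancl_induct)
      case (step x y)
      have "(v, x) \<in> overlap\<^sup>*" using step.IH S by blast
      then have "(v, y) \<in> overlap\<^sup>*" using step.hyps(2) by (rule rtrancl_into_rtrancl)
      moreover have "W (f x + f y) x y" using step.hyps(2) by (simp add: overlap_def)
      ultimately show ?case using step.IH no by blast
    qed (rule a)
    then show False using b by blast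
  qed
qed

text \<open>The clusters partition \<open>P\<close>, so their total radii add up to the cost of
  \<open>f\<close>; by \<open>U_bad\<close> their covered sets exhaust \<open>V\<close>.\<close>

lemma dominating_bound: "\<exists>h. admissible h \<and> (\<forall>u\<in>V. reached h u) \<and> 4 * sum h V \<le> 5 * sum f V"
proof -
  define \<D> where "\<D> = (\<lambda>v. overlap\<^sup>* `` {v}) ` P"
  have cl: "cluster C" if "C \<in> \<D>" for C using that cluster_overlap_class unfolding \<D>_def by blast
  have UD: "\<Union>\<D> = P" using overlap_rtrancl_P unfolding \<D>_def by blast
  have fin: "finite \<D>" using finite_P by (simp add: \<D>_def)
  have "\<exists>k. 4 * k \<le> 5 * sum R \<D> \<and> coverable (\<Union>C\<in>\<D>. covered C) k"
    by (rule clusters_coverable) (use fin cl small_cluster UD in auto)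
  then obtain k where k: "4 * k \<le> 5 * sum R \<D>" "coverable (\<Union>C\<in>\<D>. covered C) k" by blast
  have disj: "A \<inter> B = {}" if A: "A \<in> \<D>" and B: "B \<in> \<D>" and "A \<noteq> B" for A B
  proof (rule ccontr)
    assume "A \<inter> B \<noteq> {}"
    then obtain a b x where AB: "A = overlap\<^sup>* `` {a}" "B = overlap\<^sup>* `` {b}"
      and x: "(a, x) \<in> overlap\<^sup>*" "(b, x) \<in> overlap\<^sup>*" using A B unfolding \<D>_def by blast
    have ab: "(a, b) \<in> overlap\<^sup>*"
      by (rule rtrancl_trans[OF x(1) symD[OF sym_overlap x(2)]])
    have ba: "(b, a) \<in> overlap\<^sup>*" by (rule symD[OF sym_overlap ab])
    have "A = B" unfolding AB using rtrancl_trans[OF ab] rtrancl_trans[OF ba] by blast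
    then show False using \<open>A \<noteq> B\<close> by blast
  qed
  have "sum R \<D> = sum f (\<Union>\<D>)"
    unfolding R_def using sum.Union_disjoint[of \<D> f] cl cluster_finite disj by (simp add: comp_def)
  also have "\<dots> = sum f V" unfolding UD
    by (rule sum.mono_neutral_left) (use finite_V in \<open>auto simp: supp_def\<close>)
  finally have sum: "sum R \<D> = sum f V" .
  have "V \<subseteq> (\<Union>C\<in>\<D>. covered C)"
  proof
    fix u assume u: "u \<in> V"
    obtain z where z: "z \<in> P" "W (f z) z u \<or> bad z u"
    proof (cases "u \<in> U")
      case True
      then show ?thesis using U_bad that by (metis bad_def)
    next
      case False
      then show ?thesis using u that unfolding U_def by blast
    qed
    then obtain C where "C \<in> \<D>" "z \<in> C" using UD by blast
    then show "u \<in> (\<Union>C\<in>\<D>. covered C)" using z unfolding covered_def by blast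
  qed
  then obtain h where "admissible h" "\<forall>u\<in>V. reached h u" "sum h V \<le> k"
    using coverable_imp_dominating coverable_mono[OF k(2)] by blast
  then show ?thesis using k(1) sum by (intro exI[of _ h]) auto
qed

end

section \<open>Distances in graphs\<close>

definition walk_within :: "('a, 'b) pre_digraph \<Rightarrow> nat \<Rightarrow> 'a \<Rightarrow> 'a \<Rightarrow> bool" where
  "walk_within G n u v \<longleftrightarrow> (\<exists>p. pre_digraph.awalk G u p v \<and> length p \<le> n)"

lemma (in wf_digraph) awalk_cost_one: "awalk_cost (\<lambda>_. 1) p = real (length p)"
  by (induction p) auto

text \<open>Walk lengths are integers, hence \<open>Suc n\<close>; without any walk the infimum is
  infinite.\<close>

lemma gdist_ge:
  assumes "wf_digraph G" "\<not> walk_within G n u v"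
  shows "ereal (real (Suc n)) \<le> gdist G u v"
proof -
  interpret wf_digraph G by (rule assms(1))
  show ?thesis unfolding gdist_def \<mu>_def
  proof (rule INF_greatest)
    fix p assume "p \<in> {p. awalk u p v}"
    then have "\<not> length p \<le> n" using assms(2) unfolding walk_within_def by blast
    then show "ereal (real (Suc n)) \<le> ereal (awalk_cost (\<lambda>_. 1) p)"
      unfolding awalk_cost_one by simp
  qed
qed

lemma gdist_le:
  assumes "wf_digraph G" "walk_within G n u v"
  shows "gdist G u v \<le> ereal (real n)"
proof -
  interpret wf_digraph G by (rule assms(1))
  obtain p where p: "awalk u p v" "length p \<le> n" using assms(2) unfolding walk_within_def by blast
  have "gdist G u v \<le> ereal (real (length p))"
    unfolding gdist_def using min_cost_le_walk_cost[OF p(1), of "\<lambda>_. 1"] awalk_cost_one by simp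
  also have "\<dots> \<le> ereal (real n)" using p by simp
  finally show ?thesis .
qed

lemma gdist_le_iff:
  assumes "wf_digraph G"
  shows "gdist G u v \<le> ereal (real n) \<longleftrightarrow> walk_within G n u v"
proof
  assume le: "gdist G u v \<le> ereal (real n)"
  show "walk_within G n u v"
  proof (rule ccontr)
    assume "\<not> walk_within G n u v"
    from order_trans[OF gdist_ge[OF assms this] le] show False by simp
  qed
qed (rule gdist_le[OF assms])

lemma (in sym_digraph) awalk_rev:
  assumes "awalk u p v"
  shows "\<exists>q. awalk v q u \<and> length q = length p"
  using assms
proof (induction p arbitrary: u)
  case Nil
  then show ?case by (auto simp: awalk_Nil_iff intro!: exI[of _ "[]"])
next
  case (Cons e p)
  then have e: "e \<in> arcs G" "u = tail G e" and p: "awalk (head G e) p v"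
    by (auto simp: awalk_Cons_iff)
  obtain q where q: "awalk v q (head G e)" "length q = length p" using Cons.IH[OF p] by blast
  obtain e' where e': "e' \<in> arcs G" "tail G e' = head G e" "head G e' = tail G e"
    using sym_arcs e(1) unfolding symmetric_conv by metis
  have "awalk (head G e) [e'] u"
    using e e' by (auto simp: awalk_simps intro: wellformed)
  from awalk_appendI[OF q(1) this] show ?case using q(2) by (intro exI[of _ "q @ [e']"]) simp
qed

lemma (in sym_digraph) scc_closed:
  assumes H: "H \<in> sccs" and u: "u \<in> verts H" and uv: "u \<rightarrow>\<^sup>* v"
  shows "v \<in> verts H"
proof -
  have "verts H \<in> sccs_verts" using H in_sccs_vertsI_sccs by blast
  moreover have "v \<rightarrow>\<^sup>* u" using uv symmetric_reachable[OF sym_arcs] by blast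
  ultimately show ?thesis using u uv unfolding sccs_verts_def by blast
qed

lemma (in sym_digraph) walk_within_scc:
  assumes H: "H \<in> sccs" and u: "u \<in> verts H"
  shows "walk_within H n u v \<longleftrightarrow> walk_within G n u v"
proof -
  have ind: "induced_subgraph H G" using H by (rule in_sccs_imp_induced)
  then have sub: "subgraph H G" by (rule induced_imp_subgraph)
  then interpret H: wf_digraph H by (simp add: subgraph_def)
  have th: "tail H = tail G" "head H = head G" using sub by (auto simp: subgraph_def compatible_def)
  have "H.awalk u p v" if "awalk u p v" for p
    using that u
  proof (induction p arbitrary: u)
    case Nil
    then show ?case by (simp add: awalk_Nil_iff H.awalk_Nil_iff)
  next
    case (Cons e p)
    then have e: "e \<in> arcs G" "u = tail G e" and p: "awalk (head G e) p v"
      by (auto simp: awalk_Cons_iff)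
    have "u \<rightarrow>\<^sup>* head G e" using e by (metis in_arcs_imp_in_arcs_ends reachable_adjI)
    then have hH: "head G e \<in> verts H" using scc_closed[OF H Cons.prems(2)] by blast
    then have "e \<in> arcs H" using ind e Cons.prems(2) by (auto simp: induced_subgraph_def)
    then show ?case using Cons.IH[OF p hH] e th by (simp add: H.awalk_Cons_iff)
  qed
  moreover have "awalk u p v" if "H.awalk u p v" for p
    by (rule subgraph_awalk_imp_awalk[OF that sub])
  ultimately show ?thesis unfolding walk_within_def by blast
qed

section \<open>Graphs as ball spaces and translation of the broadcast notions\<close>

locale broadcast_graph = graph G for G :: "('a, 'b) pre_digraph" (structure) +
  assumes components: "\<forall>H\<in>sccs. 2 \<le> card (verts H)"
begin

lemma in_some_scc:
  assumes "u \<in> verts G"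
  obtains H where "H \<in> sccs" "u \<in> verts H"
proof -
  have "scc_of u \<in> verts ` sccs" using scc_of_in_sccs_verts[OF assms] sccs_verts_conv by simp
  then show thesis using that in_scc_of_self[OF assms] by auto
qed

lemma scc_within:
  assumes H: "H \<in> sccs" and uv: "u \<in> verts H" "v \<in> verts H"
  shows "\<exists>n. walk_within G n u v"
proof -
  have sub: "subgraph H G" using H in_sccs_imp_induced induced_imp_subgraph by blast
  then interpret H: wf_digraph H by (simp add: subgraph_def)
  have "strongly_connected H" using H by (auto simp: sccs_def)
  then obtain p where "H.awalk u p v"
    using uv unfolding strongly_connected_def H.reachable_awalk by blast
  then have "awalk u p v" using sub by (rule subgraph_awalk_imp_awalk)
  then show ?thesis unfolding walk_within_def by blast
qed

sublocale ball_space "verts G" "walk_within G"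
proof
  show "finite (verts G)" by simp
  show "v \<in> verts G" if "walk_within G n u v" for n u v
    using that awalk_last_in_verts unfolding walk_within_def by blast
  show "walk_within G 0 u v \<longleftrightarrow> u \<in> verts G \<and> u = v" for u v
    unfolding walk_within_def by (auto simp: awalk_Nil_iff)
  show "walk_within G n v u" if "walk_within G n u v" for n u v
    using that awalk_rev unfolding walk_within_def by metis
  show "walk_within G n u v" if "walk_within G m u v" "m \<le> n" for m n u v
    using that unfolding walk_within_def by (meson order_trans)
  show "walk_within G (m + n) u w" if uv: "walk_within G m u v" and vw: "walk_within G n v w" for m n u v w
  proof -
    obtain p q where "awalk u p v" "length p \<le> m" "awalk v q w" "length q \<le> n"
      using uv vw unfolding walk_within_def by blast
    then show ?thesis unfolding walk_within_def
      using awalk_appendI[of u p v q w] by (intro exI[of _ "p @ q"]) auto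
  qed
  show "\<exists>v. walk_within G m u v \<and> walk_within G n v w" if uw: "walk_within G (m + n) u w" for m n u w
  proof -
    obtain p where p: "awalk u p w" "length p \<le> m + n" using uw unfolding walk_within_def by blast
    have "awalk u (take m p @ drop m p) w" using p by simp
    then have "awalk u (take m p) (awlast u (take m p))" "awalk (awlast u (take m p)) (drop m p) w"
      unfolding awalk_append_iff by auto
    moreover have "length (take m p) \<le> m" "length (drop m p) \<le> n" using p by auto
    ultimately show ?thesis unfolding walk_within_def by blast
  qed
  \<comment> \<open>The size of components enters here: a walk to a second vertex starts with an
    arc, which is not a loop.\<close>
  show "\<exists>v. walk_within G 1 u v \<and> v \<noteq> u" if u: "u \<in> verts G" for u
  proof -
    obtain H where H: "H \<in> sccs" "u \<in> verts H" using in_some_scc[OF u] .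
    have "card (verts H) \<noteq> card {u}" using components H(1) by fastforce
    then have "verts H \<noteq> {u}" by metis
    then obtain w where w: "w \<in> verts H" "w \<noteq> u" using H(2) by blast
    then obtain n p where p: "awalk u p w" using scc_within[OF H] unfolding walk_within_def by blast
    then obtain e p' where "p = e # p'" using w by (cases p) (auto simp: awalk_Nil_iff)
    then have e: "e \<in> arcs G" "u = tail G e" using p by (auto simp: awalk_Cons_iff)
    then have "awalk u [e] (head G e)" by (auto simp: awalk_simps intro: wellformed)
    moreover have "head G e \<noteq> u" using no_loops[OF e(1)] e(2) by auto
    ultimately show ?thesis unfolding walk_within_def by (intro exI[of _ "head G e"]) auto
  qed
qed

text \<open>The supremum is over a finite set and hence attained; cutting a shortest walk to a
  vertex at distance at least \<open>n\<close> after \<open>n\<close> steps gives distance exactly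
  \<open>n\<close>.\<close>

lemma eccentricity_ge_iff:
  assumes H: "H \<in> sccs" and v: "v \<in> verts H"
  shows "ereal (real n) \<le> eccentricity H v \<longleftrightarrow>
    n = 0 \<or> (\<exists>u. walk_within G n v u \<and> \<not> walk_within G (n - 1) v u)"
proof -
  have sub: "subgraph H G" using H in_sccs_imp_induced induced_imp_subgraph by blast
  then have wfH: "wf_digraph H" and VH: "verts H \<subseteq> verts G" by (auto simp: subgraph_def)
  have finH: "finite (verts H)" by (rule finite_subset[OF VH]) simp
  have dist_ge: "ereal (real (Suc m)) \<le> gdist H u v \<longleftrightarrow> \<not> walk_within G m v u" if u: "u \<in> verts H" for m u
  proof -
    have iff: "walk_within H k u v \<longleftrightarrow> walk_within G k v u" for k
      using walk_within_scc[OF H u] W_sym by blast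
    show ?thesis
    proof
      assume le: "ereal (real (Suc m)) \<le> gdist H u v"
      show "\<not> walk_within G m v u"
      proof
        assume "walk_within G m v u"
        then have "walk_within H m u v" unfolding iff .
        from order_trans[OF le gdist_le[OF wfH this]] show False by simp
      qed
    next
      assume "\<not> walk_within G m v u"
      then have "\<not> walk_within H m u v" unfolding iff .
      then show "ereal (real (Suc m)) \<le> gdist H u v" by (rule gdist_ge[OF wfH])
    qed
  qed
  have fin: "finite ((\<lambda>u. gdist H u v) ` verts H)" and ne: "(\<lambda>u. gdist H u v) ` verts H \<noteq> {}"
    using finH v by auto
  show ?thesis
  proof (cases n)
    case 0
    have "gdist H v v \<le> eccentricity H v" unfolding eccentricity_def by (rule SUP_upper[OF v])
    moreover have "0 \<le> gdist H v v"
    proof -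
      interpret H: wf_digraph H by (rule wfH)
      show ?thesis unfolding gdist_def H.\<mu>_def
        by (rule INF_greatest) (simp add: H.awalk_cost_one)
    qed
    ultimately show ?thesis using 0 order_trans by (auto simp: zero_ereal_def[symmetric])
  next
    case (Suc m)
    have "ereal (real n) \<le> eccentricity H v \<longleftrightarrow> (\<exists>u\<in>verts H. ereal (real n) \<le> gdist H u v)"
      unfolding eccentricity_def using Max_ge_iff[OF fin ne] cSup_eq_Max[OF fin ne] by simp
    also have "\<dots> \<longleftrightarrow> (\<exists>u\<in>verts H. \<not> walk_within G m v u)" using dist_ge Suc by blast
    also have "\<dots> \<longleftrightarrow> (\<exists>u. walk_within G n v u \<and> \<not> walk_within G m v u)"
    proof
      assume "\<exists>u\<in>verts H. \<not> walk_within G m v u"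
      then obtain u where u: "u \<in> verts H" "\<not> walk_within G m v u" by blast
      define d where "d = (LEAST d. walk_within G d v u)"
      have d: "walk_within G d v u" unfolding d_def by (rule LeastI_ex) (rule scc_within[OF H v u(1)])
      have dm: "m < d" using u(2) d W_mono by (meson not_less)
      then have "walk_within G (n + (d - n)) v u" using d Suc by simp
      then obtain w where w: "walk_within G n v w" "walk_within G (d - n) w u" using W_split by blast
      have "\<not> walk_within G m v w"
      proof
        assume "walk_within G m v w"
        from W_trans[OF this w(2)] have "walk_within G (d - 1) v u" using dm Suc by simp
        then have "d \<le> d - 1" unfolding d_def by (rule Least_le)
        then show False using dm by simp
      qed
      then show "\<exists>u. walk_within G n v u \<and> \<not> walk_within G m v u" using w by blast
    next
      assume "\<exists>u. walk_within G n v u \<and> \<not> walk_within G m v u"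
      then obtain u where u: "walk_within G n v u" "\<not> walk_within G m v u" by blast
      then have "v \<rightarrow>\<^sup>* u" unfolding walk_within_def reachable_awalk by blast
      then show "\<exists>u\<in>verts H. \<not> walk_within G m v u" using scc_closed[OF H v] u by blast
    qed
    finally show ?thesis using Suc by simp
  qed
qed

text \<open>The diameter bound follows from the eccentricity bound, and every vertex lies in some
  component.\<close>

lemma broadcast_iff: "broadcast G g \<longleftrightarrow> admissible g"
proof -
  have diam: "eccentricity H v \<le> diam H" if "v \<in> verts H" for H :: "('a, 'b) pre_digraph" and v
    unfolding diam_def by (rule SUP_upper[OF that])
  have VH: "verts H \<subseteq> verts G" if "H \<in> sccs" for H
    using that in_sccs_imp_induced induced_imp_subgraph by (auto simp: subgraph_def)
  have "broadcast G g \<longleftrightarrow> (\<forall>H\<in>sccs. \<forall>v\<in>verts H. ereal (real (g v)) \<le> eccentricity H v)"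
    unfolding broadcast_def connected_broadcast_def using diam order_trans by blast
  also have "\<dots> \<longleftrightarrow> (\<forall>H\<in>sccs. \<forall>v\<in>verts H.
      g v = 0 \<or> (\<exists>u. walk_within G (g v) v u \<and> \<not> walk_within G (g v - 1) v u))"
    using eccentricity_ge_iff by blast
  also have "\<dots> \<longleftrightarrow> admissible g"
    unfolding admissible_def
  proof (intro iffI ballI)
    fix v assume all: "\<forall>H\<in>sccs. \<forall>v\<in>verts H.
        g v = 0 \<or> (\<exists>u. walk_within G (g v) v u \<and> \<not> walk_within G (g v - 1) v u)"
      and v: "v \<in> verts G"
    obtain H where H: "H \<in> sccs" "v \<in> verts H" using in_some_scc[OF v] .
    show "g v = 0 \<or> (\<exists>u. walk_within G (g v) v u \<and> \<not> walk_within G (g v - 1) v u)"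
      by (rule bspec[OF bspec[OF all H(1)] H(2)])
  next
    fix H v assume all: "\<forall>v\<in>verts G.
        g v = 0 \<or> (\<exists>u. walk_within G (g v) v u \<and> \<not> walk_within G (g v - 1) v u)"
      and H: "H \<in> sccs" "v \<in> verts H"
    show "g v = 0 \<or> (\<exists>u. walk_within G (g v) v u \<and> \<not> walk_within G (g v - 1) v u)"
      by (rule bspec[OF all subsetD[OF VH[OF H(1)] H(2)]])
  qed
  finally show ?thesis .
qed

lemma dist_iff: "gdist G u v \<le> ereal (real n) \<longleftrightarrow> walk_within G n v u"
  using gdist_le_iff[OF wf_digraph] W_sym by blast

lemma Vplus_eq: "Vplus G g = supp g"
  unfolding Vplus_def supp_def by simp

lemma dominated_iff: "dominated G g u \<longleftrightarrow> reached g u"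
  unfolding dominated_def hears_def reached_def Vplus_eq dist_iff by blast

lemma private_boundary_eq: "private_boundary G g v = pb g v"
  unfolding private_boundary_def broadcast_nbhd_def pb_def dominated_iff dist_iff using W_in by blast

lemma irredundant_iff: "irredundant_broadcast G g \<longleftrightarrow> irr g"
  unfolding irredundant_broadcast_def irr_def broadcast_iff Vplus_eq private_boundary_eq ..

text \<open>Ensures that the \<open>LEAST\<close> in \<open>broadcast_irredundance_number\<close> is
  attained. An irredundant broadcast of greatest cost is maximal.\<close>

lemma maximal_irredundant_exists: "\<exists>f. maximal_irredundant_broadcast G f"
proof -
  \<comment> \<open>Each value of an irredundant broadcast is at most some distance. For unreachable
    pairs the \<open>LEAST\<close> is an arbitrary natural number, harmless in an upper
    bound.\<close>
  define B where "B = (\<Sum>v\<in>verts G. \<Sum>u\<in>verts G. LEAST n. walk_within G n v u)"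
  have bound: "cost G g \<le> B" if g: "irr g" for g
    unfolding cost_def B_def
  proof (rule sum_mono)
    fix v assume v: "v \<in> verts G"
    show "g v \<le> (\<Sum>u\<in>verts G. LEAST n. walk_within G n v u)"
    proof (cases "g v = 0")
      case False
      have "admissible g" using g by (simp add: irr_def)
      from bspec[OF this[unfolded admissible_def] v]
      obtain u where u: "walk_within G (g v) v u" "\<not> walk_within G (g v - 1) v u"
        using False by (elim disjE) auto
      have "g v \<le> (LEAST n. walk_within G n v u)"
      proof (rule ccontr)
        assume "\<not> ?thesis"
        then have "(LEAST n. walk_within G n v u) \<le> g v - 1" by simp
        with LeastI[of "\<lambda>n. walk_within G n v u", OF u(1)] show False using W_mono u(2) by blast
      qed
      also have "\<dots> \<le> (\<Sum>u\<in>verts G. LEAST n. walk_within G n v u)"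
        by (rule member_le_sum) (use W_in u in auto)
      finally show ?thesis .
    qed simp
  qed
  have "irr (\<lambda>_. 0)" by (simp add: irr_def admissible_def supp_def)
  then have "\<exists>f. irr f \<and> (\<forall>g. irr g \<longrightarrow> cost G g \<le> cost G f)"
    using bound by (intro ex_has_greatest_nat[where k = "\<lambda>_. 0" and b = "Suc B"]) (simp_all add: less_Suc_eq_le)
  then obtain f where f: "irr f" "\<And>g. irr g \<Longrightarrow> cost G g \<le> cost G f" by blast
  have "\<not> irr g" if g: "broadcast_less G f g" for g
  proof -
    have "cost G f < cost G g"
      unfolding cost_def by (rule sum_strict_mono_ex1) (use g in \<open>auto simp: broadcast_less_def\<close>)
    then show ?thesis using f(2) by (meson not_le)
  qed
  then show ?thesis using f(1) unfolding maximal_irredundant_broadcast_def irredundant_iff by blast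
qed

lemma broadcast_number_bound: "4 * broadcast_number G \<le> 5 * broadcast_irredundance_number G"
proof -
  have "\<exists>k f. maximal_irredundant_broadcast G f \<and> cost G f = k"
    using maximal_irredundant_exists by blast
  from LeastI_ex[OF this] obtain f where f: "maximal_irredundant_broadcast G f"
    and cost_f: "cost G f = broadcast_irredundance_number G"
    unfolding broadcast_irredundance_number_def by blast
  interpret maximal_irredundant "verts G" "walk_within G" f
  proof
    show "irr f" using f unfolding maximal_irredundant_broadcast_def irredundant_iff by blast
    show "g v = f v" if "irr g" "\<And>v. v \<in> verts G \<Longrightarrow> f v \<le> g v" "v \<in> verts G" for g v
    proof (rule ccontr)
      assume "g v \<noteq> f v"
      then have "f v < g v" using that(2,3) by (simp add: order_less_le)
      then have "broadcast_less G f g" using that(2,3) unfolding broadcast_less_def by blast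
      then show False
        using f that(1) unfolding maximal_irredundant_broadcast_def irredundant_iff by blast
    qed
  qed
  obtain h where h: "admissible h" "\<forall>u\<in>verts G. reached h u"
    "4 * sum h (verts G) \<le> 5 * sum f (verts G)" using dominating_bound by blast
  have "dominating_broadcast G h"
    using h(1,2) unfolding dominating_broadcast_def broadcast_iff dominated_iff by blast
  then have "broadcast_number G \<le> cost G h"
    unfolding broadcast_number_def by (intro Least_le) blast
  then show ?thesis using h(3) cost_f unfolding cost_def by linarith
qed

end

section \<open>The bound\<close>

theorem theorem1:
  fixes G :: "('a, 'b) pre_digraph"
  assumes "graph G"
    and "\<forall>H\<in>pre_digraph.sccs G. 2 \<le> card (verts H)"
  shows "real (broadcast_number G) \<le> 5 / 4 * real (broadcast_irredundance_number G)"
proof -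
  interpret graph G by (rule assms(1))
  interpret broadcast_graph G by unfold_locales (rule assms(2))
  show ?thesis using broadcast_number_bound by linarith
qed

end
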